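(* For all integers $n \geq 2$ and $k \geq 3$, the measure rings $\Theta(C_n\mathfrak{T})$ and $\Theta(C_n\mathfrak{T}_k)$ are both isomorphic to the zero ring. Consequently there are no ($\mathbb{C}$-valued) measures on $C_n\mathfrak{T}$ or on $C_n\mathfrak{T}_k$.
   Context: A structure is a set with a family of relations; an embedding is an injective map that is an isomorphism onto the induced substructure on its image. Given embeddings $i:W\to X$, $j:W\to Y$, an amalgamation of $X$ and $Y$ over $W$ is a structure $Z$ with jointly surjective embeddings $j':X\to Z$, $i':Y\to Z$ such that $i'\circ j=j'\circ i$; amalgamations are taken up to isomorphism compatible with these maps. A Fraïssé class is a class $\mathfrak{F}$ of finite structures closed under isomorphism and substructures, having finitely many isomorphism classes of each size, and such that for all $X,Y\in\mathfrak{F}$ and embeddings of a common $W\in\mathfrak{F}$ (possibly empty) into them, some amalgamation of $X,Y$ over $W$ lies in $\mathfrak{F}$. The measure ring $\Theta(\mathfrak{F})$ is the commutative ring generated by symbols $[i]$, one for each embedding $i$ in $\mathfrak{F}$, subject to: $[i]=1$ if $i$ is an isomorphism; $[j\circ i]=[j][i]$ for composable embeddings; and for embeddings $i:W\to X$, $j:W\to Y$, $[i]=\sum_{k=1}^m [i'_k]$ where $Z_1,\dots,Z_m$ are all the amalgamations of $X$ and $Y$ over $W$ lying in $\mathfrak{F}$ and $i'_k:Y\to Z_k$ the corresponding embeddings. A measure on $\mathfrak{F}$ is a $\mathbb{C}$-valued function on embeddings satisfying the same three rules, equivalently a ring homomorphism $\Theta(\mathfrak{F})\to\mathbb{C}$.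 For a finite tree $T$ with leaf set $L(T)$, let $R$ be the quartic relation on $L(T)$ with $R(a,b;c,d)$ true iff $a,b,c,d$ are distinct and the simple path from $a$ to $b$ is disjoint from the simple path from $c$ to $d$. An $n$-colored tree structure is $L(T)$ equipped with $R$ and a coloring $\sigma:L(T)\to\{1,\dots,n\}$ (given as unary relations). $C_n\mathfrak{T}$ is the class of all structures isomorphic to $n$-colored tree structures, and $C_n\mathfrak{T}_k$ is the subclass coming from trees all of whose vertices have degree at most $k$ (trees may be taken reduced, i.e. without degree-two vertices). These are Fraïssé classes. *)

theory Defs
  imports
    "HOL-Library.FuncSet"
    "HOL-Library.Poly_Mapping"
    "HOL-Library.Infinite_Typeclass"
    "Graph_Theory.Pair_Digraph"
    "HOL-Algebra.QuotRing"
begin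

section \<open>Relational structures and embeddings\<close>

text \<open>Relations are sets of lists (of possibly mixed arity), indexed by the symbols \<open>'s\<close>.\<close>

record ('a, 's) rstruct =
  pts :: "'a set"
  rel :: "'s \<Rightarrow> 'a list set"

definition is_structure :: "('a, 's) rstruct \<Rightarrow> bool" where
  "is_structure X \<longleftrightarrow> (\<forall>s. rel X s \<subseteq> lists (pts X))"

definition induced :: "('a, 's) rstruct \<Rightarrow> 'a set \<Rightarrow> ('a, 's) rstruct" where
  "induced X A = \<lparr>pts = A, rel = (\<lambda>s. rel X s \<inter> lists A)\<rparr>"

text \<open>Maps out of \<open>X\<close> are extensional (\<open>undefined\<close> off \<open>pts X\<close>), so that equality of HOL
  functions is equality of maps; composites are formed with \<^const>\<open>compose\<close>.\<close>

definition iso_map :: "('a, 's) rstruct \<Rightarrow> ('b, 's) rstruct \<Rightarrow> ('a \<Rightarrow> 'b) \<Rightarrow> bool" where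
  "iso_map X Y f \<longleftrightarrow> f \<in> extensional (pts X) \<and> bij_betw f (pts X) (pts Y) \<and>
     (\<forall>s. \<forall>xs \<in> lists (pts X). xs \<in> rel X s \<longleftrightarrow> map f xs \<in> rel Y s)"

definition isomorphic :: "('a, 's) rstruct \<Rightarrow> ('b, 's) rstruct \<Rightarrow> bool" where
  "isomorphic X Y \<longleftrightarrow> (\<exists>f. iso_map X Y f)"

definition embedding :: "('a, 's) rstruct \<Rightarrow> ('b, 's) rstruct \<Rightarrow> ('a \<Rightarrow> 'b) \<Rightarrow> bool" where
  "embedding X Y f \<longleftrightarrow> f \<in> pts X \<rightarrow>\<^sub>E pts Y \<and> iso_map X (induced Y (f ` pts X)) f"

text \<open>A class of finite structures is represented by the set of its members with underlying set
  in a fixed infinite type \<open>'a\<close>; every finite structure has an isomorphic copy there. An embedding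
  is a triple (source, map, target).\<close>

type_synonym ('a, 's) emb = "('a, 's) rstruct \<times> ('a \<Rightarrow> 'a) \<times> ('a, 's) rstruct"

definition embs :: "('a, 's) rstruct set \<Rightarrow> ('a, 's) emb set" where
  "embs F = {(X, f, Y). X \<in> F \<and> Y \<in> F \<and> embedding X Y f}"


section \<open>Amalgamations\<close>

text \<open>For \<open>i : W \<rightarrow> X\<close> and \<open>j : W \<rightarrow> Y\<close>, a triple \<open>(Z, j', i')\<close> consists of the amalgamation \<open>Z\<close> and
  its maps \<open>j' : X \<rightarrow> Z\<close>, \<open>i' : Y \<rightarrow> Z\<close>.\<close>

type_synonym ('a, 's) amalg = "('a, 's) rstruct \<times> ('a \<Rightarrow> 'a) \<times> ('a \<Rightarrow> 'a)"

definition amalgs ::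
  "('a, 's) rstruct set \<Rightarrow> ('a, 's) rstruct \<Rightarrow> ('a, 's) rstruct \<Rightarrow> ('a, 's) rstruct \<Rightarrow>
   ('a \<Rightarrow> 'a) \<Rightarrow> ('a \<Rightarrow> 'a) \<Rightarrow> ('a, 's) amalg set" where
  "amalgs F W X Y i j = {(Z, j', i'). Z \<in> F \<and> embedding X Z j' \<and> embedding Y Z i' \<and>
     pts Z = j' ` pts X \<union> i' ` pts Y \<and> compose (pts W) i' j = compose (pts W) j' i}"

definition amalg_equiv ::
  "('a, 's) rstruct \<Rightarrow> ('a, 's) rstruct \<Rightarrow> ('a, 's) amalg \<Rightarrow> ('a, 's) amalg \<Rightarrow> bool" where
  "amalg_equiv X Y = (\<lambda>(Z, j', i') (Z', j'', i'').
     \<exists>\<phi>. iso_map Z Z' \<phi> \<and> compose (pts X) \<phi> j' = j'' \<and> compose (pts Y) \<phi> i' = i'')"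

text \<open>\<open>S\<close> is a list \<open>Z\<^sub>1, \<dots>, Z\<^sub>m\<close> of all amalgamations in \<open>F\<close>, up to isomorphism. It is finite for every
  Fraisse class; finiteness is stated because sums over infinite sets are 0 in HOL.\<close>

definition all_amalgs ::
  "('a, 's) rstruct set \<Rightarrow> ('a, 's) rstruct \<Rightarrow> ('a, 's) rstruct \<Rightarrow> ('a, 's) rstruct \<Rightarrow>
   ('a \<Rightarrow> 'a) \<Rightarrow> ('a \<Rightarrow> 'a) \<Rightarrow> ('a, 's) amalg set \<Rightarrow> bool" where
  "all_amalgs F W X Y i j S \<longleftrightarrow> finite S \<and> S \<subseteq> amalgs F W X Y i j \<and>
     (\<forall>A \<in> amalgs F W X Y i j. \<exists>!B. B \<in> S \<and> amalg_equiv X Y A B)"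


section \<open>The measure ring and measures\<close>

text \<open>The polynomial ring \<open>\<int>[V]\<close>: monomials are finitely supported exponent functions
  \<open>'x \<Rightarrow>\<^sub>0 nat\<close>, polynomials are finitely supported integer functions on monomials.\<close>

definition int_poly_ring :: "'x set \<Rightarrow> (('x \<Rightarrow>\<^sub>0 nat) \<Rightarrow>\<^sub>0 int) ring" where
  "int_poly_ring V = \<lparr>carrier = {p. \<forall>m \<in> Poly_Mapping.keys p. Poly_Mapping.keys m \<subseteq> V},
     mult = (*), one = 1, zero = 0, add = (+)\<rparr>"

definition var :: "'x \<Rightarrow> ('x \<Rightarrow>\<^sub>0 nat) \<Rightarrow>\<^sub>0 int" where
  "var x = Poly_Mapping.single (Poly_Mapping.single x 1) 1"

definition Theta_rels ::
  "('a, 's) rstruct set \<Rightarrow> ((('a, 's) emb \<Rightarrow>\<^sub>0 nat) \<Rightarrow>\<^sub>0 int) set" where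
  "Theta_rels F =
     {var (X, f, Y) - 1 | X f Y. (X, f, Y) \<in> embs F \<and> iso_map X Y f} \<union>
     {var (X, compose (pts X) g f, Z) - var (Y, g, Z) * var (X, f, Y) | X f Y g Z.
        (X, f, Y) \<in> embs F \<and> (Y, g, Z) \<in> embs F} \<union>
     {var (W, i, X) - (\<Sum>(Z, j', i') \<in> S. var (Y, i', Z)) | W i X j Y S.
        (W, i, X) \<in> embs F \<and> (W, j, Y) \<in> embs F \<and> all_amalgs F W X Y i j S}"

definition Theta ::
  "('a, 's) rstruct set \<Rightarrow> ((('a, 's) emb \<Rightarrow>\<^sub>0 nat) \<Rightarrow>\<^sub>0 int) set ring" where
  "Theta F = int_poly_ring (embs F) Quot (Idl\<^bsub>int_poly_ring (embs F)\<^esub> (Theta_rels F))"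

definition zero_ring :: "unit ring" where
  "zero_ring = \<lparr>carrier = {()}, mult = (\<lambda>_ _. ()), one = (), zero = (), add = (\<lambda>_ _. ())\<rparr>"

text \<open>Only the values of \<open>\<mu>\<close> on \<open>embs F\<close> matter.\<close>

definition emb_measure :: "('a, 's) rstruct set \<Rightarrow> (('a, 's) emb \<Rightarrow> complex) \<Rightarrow> bool" where
  "emb_measure F \<mu> \<longleftrightarrow>
     (\<forall>X f Y. (X, f, Y) \<in> embs F \<and> iso_map X Y f \<longrightarrow> \<mu> (X, f, Y) = 1) \<and>
     (\<forall>X f Y g Z. (X, f, Y) \<in> embs F \<and> (Y, g, Z) \<in> embs F \<longrightarrow>
        \<mu> (X, compose (pts X) g f, Z) = \<mu> (Y, g, Z) * \<mu> (X, f, Y)) \<and>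
     (\<forall>W i X j Y S. (W, i, X) \<in> embs F \<and> (W, j, Y) \<in> embs F \<and> all_amalgs F W X Y i j S \<longrightarrow>
        \<mu> (W, i, X) = (\<Sum>(Z, j', i') \<in> S. \<mu> (Y, i', Z)))"


section \<open>Colored tree structures\<close>

text \<open>Graphs are finite symmetric loopless digraphs. The predicate \<open>tree\<close> of
  \<open>Graph_Theory.Digraph_Component\<close> is not usable here: it excludes directed cycles only, and every
  edge of a symmetric digraph is a directed cycle of length 2. The empty graph is admitted, because
  the empty structure belongs to the classes below.\<close>

definition is_tree :: "'v pair_pre_digraph \<Rightarrow> bool" where
  "is_tree T \<longleftrightarrow> pair_graph T \<and>
     (\<forall>u \<in> pverts T. \<forall>v \<in> pverts T. \<exists>!p. pre_digraph.apath (with_proj T) u p v)"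

text \<open>In a symmetric digraph the out-degree is the degree of the undirected graph. The vertex of a
  one-vertex tree counts as a leaf: one-point structures are substructures of larger ones.\<close>

definition leaves :: "'v pair_pre_digraph \<Rightarrow> 'v set" where
  "leaves T = {v \<in> pverts T. out_degree (with_proj T) v \<le> 1}"

definition path_vertices :: "'v pair_pre_digraph \<Rightarrow> 'v \<Rightarrow> 'v \<Rightarrow> 'v set" where
  "path_vertices T u v = set (pawalk_verts u (THE p. pre_digraph.apath (with_proj T) u p v))"

datatype tree_sym = Quartic | Color nat

definition tree_structure :: "'v pair_pre_digraph \<Rightarrow> ('v \<Rightarrow> nat) \<Rightarrow> ('v, tree_sym) rstruct" where
  "tree_structure T \<sigma> = \<lparr>pts = leaves T, rel = (\<lambda>s. case s of
       Quartic \<Rightarrow> {[a, b, c, d] | a b c d. {a, b, c, d} \<subseteq> leaves T \<and> distinct [a, b, c, d] \<and>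
                     path_vertices T a b \<inter> path_vertices T c d = {}}
     | Color c \<Rightarrow> {[a] | a. a \<in> leaves T \<and> \<sigma> a = c})\<rparr>"

text \<open>Every finite tree has a copy with vertices in \<open>nat\<close>. The relations \<open>Color c\<close> with
  \<open>c \<notin> {1..n}\<close> are empty on all members of the classes and impose nothing.\<close>

definition colored_trees :: "nat \<Rightarrow> ('a, tree_sym) rstruct set" where
  "colored_trees n = {X. is_structure X \<and> (\<exists>(T :: nat pair_pre_digraph) \<sigma>.
     is_tree T \<and> \<sigma> \<in> leaves T \<rightarrow> {1..n} \<and> isomorphic X (tree_structure T \<sigma>))}"

definition colored_trees_deg :: "nat \<Rightarrow> nat \<Rightarrow> ('a, tree_sym) rstruct set" where
  "colored_trees_deg n k = {X. is_structure X \<and> (\<exists>(T :: nat pair_pre_digraph) \<sigma>.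
     is_tree T \<and> (\<forall>v \<in> pverts T. out_degree (with_proj T) v \<le> k) \<and>
     \<sigma> \<in> leaves T \<rightarrow> {1..n} \<and> isomorphic X (tree_structure T \<sigma>))}"


section \<open>The measure ring is a commutative ring\<close>

lemma cring_int_poly_ring: "cring (int_poly_ring V)"
proof -
  let ?C = "{p :: ('a \<Rightarrow>\<^sub>0 nat) \<Rightarrow>\<^sub>0 int. \<forall>m \<in> Poly_Mapping.keys p. Poly_Mapping.keys m \<subseteq> V}"
  have add: "p + q \<in> ?C" if "p \<in> ?C" "q \<in> ?C" for p q
    using that keys_add[of p q] by blast
  have mult: "p * q \<in> ?C" if "p \<in> ?C" "q \<in> ?C" for p q
  proof (intro CollectI ballI)
    fix m assume "m \<in> Poly_Mapping.keys (p * q)"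
    then obtain a b where "m = a + b" "a \<in> Poly_Mapping.keys p" "b \<in> Poly_Mapping.keys q"
      using keys_mult[of p q] by blast
    then show "Poly_Mapping.keys m \<subseteq> V" using that keys_add[of a b] by blast
  qed
  have uminus: "- p \<in> ?C" if "p \<in> ?C" for p
    using that by (simp add: Poly_Mapping.keys.rep_eq)
  let ?R = "int_poly_ring V"
  have ops: "carrier ?R = ?C" "\<And>p q. p \<oplus>\<^bsub>?R\<^esub> q = p + q" "\<And>p q. p \<otimes>\<^bsub>?R\<^esub> q = p * q"
      "\<zero>\<^bsub>?R\<^esub> = 0" "\<one>\<^bsub>?R\<^esub> = 1"
    by (simp_all add: int_poly_ring_def)
  have zero_one: "0 \<in> ?C" "1 \<in> ?C" by simp_all
  show ?thesis
  proof (rule cringI)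
    show "abelian_group ?R"
    proof (rule abelian_groupI, unfold ops)
      fix p assume "p \<in> ?C"
      then show "\<exists>q \<in> ?C. q + p = 0" by (intro bexI[OF _ uminus]) simp_all
    qed (rule add zero_one add.assoc add.commute add_0_left; assumption?)+
    show "comm_monoid ?R"
      by (rule comm_monoidI, unfold ops)
        (rule mult zero_one mult.assoc mult.commute mult_1_left; assumption?)+
  qed (unfold ops, rule distrib_right)
qed

lemma embedding_compose:
  assumes f: "embedding X Y f" and g: "embedding Y Z g"
  shows "embedding X Z (compose (pts X) g f)"
proof -
  have fm: "f \<in> pts X \<rightarrow> pts Y" and gm: "g \<in> pts Y \<rightarrow> pts Z"
    and inj: "inj_on f (pts X)" "inj_on g (pts Y)"
    and fr: "\<And>s xs. xs \<in> lists (pts X) \<Longrightarrow> xs \<in> rel X s \<longleftrightarrow> map f xs \<in> rel Y s"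
    and gr: "\<And>s xs. xs \<in> lists (pts Y) \<Longrightarrow> xs \<in> rel Y s \<longleftrightarrow> map g xs \<in> rel Z s"
    using f g by (auto simp: embedding_def iso_map_def induced_def bij_betw_def)
  let ?h = "compose (pts X) g f"
  have hm: "?h \<in> pts X \<rightarrow>\<^sub>E pts Z"
    using fm gm by (simp add: compose_def Pi_def PiE_def)
  have hinj: "inj_on ?h (pts X)"
    using inj fm by (simp add: inj_on_def compose_def Pi_def)
  have hr: "xs \<in> rel X s \<longleftrightarrow> map ?h xs \<in> rel Z s" if xs: "xs \<in> lists (pts X)" for xs s
  proof -
    have h: "map ?h xs = map g (map f xs)"
      using xs by (auto simp: compose_def)
    have "map f xs \<in> lists (pts Y)" using xs fm by (auto simp: Pi_def)
    then show ?thesis unfolding h using fr[OF xs, of s] gr[of "map f xs" s] by blast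
  qed
  have hl: "map ?h xs \<in> lists (?h ` pts X)" if xs: "xs \<in> lists (pts X)" for xs
    using xs by auto
  show ?thesis
    unfolding embedding_def iso_map_def induced_def bij_betw_def
    using hm hinj hr hl by (simp add: PiE_def del: in_lists_conv_set)
qed

lemma Theta_rels_subset: "Theta_rels F \<subseteq> carrier (int_poly_ring (embs F))"
proof -
  let ?R = "int_poly_ring (embs F)"
  interpret R: cring ?R by (rule cring_int_poly_ring)
  have var: "var x \<in> carrier ?R" if "x \<in> embs F" for x
    using that by (auto simp: var_def int_poly_ring_def)
  have one: "1 \<in> carrier ?R" and zero: "0 \<in> carrier ?R"
    using R.one_closed R.zero_closed by (simp_all add: int_poly_ring_def)
  have mult: "p * q \<in> carrier ?R" and add: "p + q \<in> carrier ?R"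
    if "p \<in> carrier ?R" "q \<in> carrier ?R" for p q
    using R.m_closed[OF that] R.add.m_closed[OF that] by (simp_all add: int_poly_ring_def)
  have uminus: "- p \<in> carrier ?R" if "p \<in> carrier ?R" for p
    using that by (simp add: int_poly_ring_def Poly_Mapping.keys.rep_eq)
  have diff: "p - q \<in> carrier ?R" if "p \<in> carrier ?R" "q \<in> carrier ?R" for p q
    using add[OF that(1) uminus[OF that(2)]] by simp
  have sum: "sum h S \<in> carrier ?R" if "\<And>x. x \<in> S \<Longrightarrow> h x \<in> carrier ?R" for h and S :: "'x set"
    using that by (induction S rule: infinite_finite_induct) (auto intro: zero add)
  have embs_comp: "(X, compose (pts X) g f, Z) \<in> embs F"
    if "(X, f, Y) \<in> embs F" "(Y, g, Z) \<in> embs F" for X f Y g Z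
    using that embedding_compose by (auto simp: embs_def)
  have embs_amalg: "(Y, i', Z) \<in> embs F"
    if "(W, j, Y) \<in> embs F" "all_amalgs F W X Y i j S" "(Z, j', i') \<in> S" for W X Y i j S Z j' i'
    using that by (auto simp: embs_def all_amalgs_def amalgs_def)
  show ?thesis
  proof
    fix p assume "p \<in> Theta_rels F"
    then consider
      (iso) X f Y where "p = var (X, f, Y) - 1" "(X, f, Y) \<in> embs F"
    | (comp) X f Y g Z where "p = var (X, compose (pts X) g f, Z) - var (Y, g, Z) * var (X, f, Y)"
        "(X, f, Y) \<in> embs F" "(Y, g, Z) \<in> embs F"
    | (amalg) W i X j Y S where "p = var (W, i, X) - (\<Sum>(Z, j', i') \<in> S. var (Y, i', Z))"
        "(W, i, X) \<in> embs F" "(W, j, Y) \<in> embs F" "all_amalgs F W X Y i j S"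
      unfolding Theta_rels_def by blast
    then show "p \<in> carrier ?R"
    proof cases
      case iso
      show ?thesis unfolding iso(1) by (intro diff var one iso(2))
    next
      case comp
      show ?thesis unfolding comp(1)
        by (intro diff mult var embs_comp[OF comp(2,3)] comp(2,3))
    next
      case amalg
      have "(case A of (Z, j', i') \<Rightarrow> var (Y, i', Z)) \<in> carrier ?R" if "A \<in> S" for A
        using var embs_amalg[OF amalg(3,4)] that by (cases A) auto
      then show ?thesis unfolding amalg(1) by (intro diff sum var amalg(2))
    qed
  qed
qed

lemma cring_Theta: "cring (Theta F)"
proof -
  interpret cring "int_poly_ring (embs F)" by (rule cring_int_poly_ring)
  show ?thesis
    unfolding Theta_def
    by (rule ideal.quotient_is_cring[OF genideal_ideal[OF Theta_rels_subset] cring_int_poly_ring])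
qed

end

theory Submission
  imports Defs
begin

text \<open>Fix distinct leaves \<open>d, e, f\<close> and let \<open>B d x\<close> be the class of the embedding of \<open>{d, e, f}\<close> into the
  quartet \<open>dx|ef\<close>. Amalgamating a quartet with a one-point extension of a triple shows that \<open>B d x\<close>
  depends only on the colours of \<open>d\<close> and \<open>x\<close>. The five-leaf trees that extend the quartet \<open>cd|ef\<close> by a
  leaf \<open>x\<close> off the branches of \<open>e\<close> and \<open>f\<close> are the same for both triples \<open>{d, e, f}\<close> and \<open>{c, e, f}\<close>,
  which gives \<open>B d x - [x = c] = B c x - [x = d]\<close> on colours. Adding \<open>c\<close> and \<open>x\<close> as a cherry on the
  branch of \<open>d\<close> in either order gives \<open>B c x * B d c = B x c * B d x\<close>. For the colours 1 and 2 these
  relations force \<open>B 1 2 = B 2 1 = 0\<close> and \<open>B 1 1 = B 2 2 = -1\<close>. Finally let \<open>g\<close> be the class of inserting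
  a leaf \<open>x\<close> on the inner edge of \<open>cd|ef\<close>. Adding \<open>c\<close> and \<open>x\<close> one after the other gives
  \<open>g * B d c = B d c * B d x\<close>, and as \<open>g\<close> is symmetric in the two sides of the edge, also
  \<open>g * B f e = B f e * B f x\<close>. With \<open>c, d, x\<close> of colour 1 and \<open>e, f\<close> of colour 2 this says
  \<open>g = -1\<close> and \<open>g = 0\<close>.\<close>

section \<open>Paths in trees\<close>

text \<open>Path vertex sets seen abstractly: \<open>I u v\<close> stands for the vertices on the
  path from \<open>u\<close> to \<open>v\<close>. The quartet axioms of a tree follow from these
  seven properties, without reference to arcs.\<close>

locale tree_interval =
  fixes V :: "'v set" and I :: "'v \<Rightarrow> 'v \<Rightarrow> 'v set"
  assumes finite_I: "\<lbrakk>u \<in> V; v \<in> V\<rbrakk> \<Longrightarrow> finite (I u v)"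
    and I_subset: "\<lbrakk>u \<in> V; v \<in> V\<rbrakk> \<Longrightarrow> I u v \<subseteq> V"
    and left_in_I: "\<lbrakk>u \<in> V; v \<in> V\<rbrakk> \<Longrightarrow> u \<in> I u v"
    and I_commute: "\<lbrakk>u \<in> V; v \<in> V\<rbrakk> \<Longrightarrow> I u v = I v u"
    and I_triangle: "\<lbrakk>u \<in> V; v \<in> V; w \<in> V\<rbrakk> \<Longrightarrow> I u w \<subseteq> I u v \<union> I v w"
    and I_split: "\<lbrakk>u \<in> V; v \<in> V; w \<in> I u v\<rbrakk> \<Longrightarrow> I u w \<subseteq> I u v \<and> I u w \<inter> I w v = {w}"
    and I_join: "\<lbrakk>u \<in> V; v \<in> V; w \<in> V; I u w \<inter> I w v = {w}\<rbrakk> \<Longrightarrow> w \<in> I u v"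

lemma tree_interval_path_vertices:
  assumes "is_tree T"
  shows "tree_interval (pverts T) (path_vertices T)"
proof -
  interpret pair_graph T using assms by (simp add: is_tree_def)
  have ex1: "\<exists>!p. apath u p v" if "u \<in> pverts T" "v \<in> pverts T" for u v
    using assms that by (simp add: is_tree_def)
  have eq: "path_vertices T u v = set (pawalk_verts u p)" if "apath u p v" for u p v
  proof -
    have "u \<in> pverts T" "v \<in> pverts T" using that by (auto simp: apath_def)
    then have "(THE p. apath u p v) = p" using ex1 that by blast
    then show ?thesis by (simp add: path_vertices_def)
  qed
  have ap: "\<exists>p. apath u p v \<and> path_vertices T u v = set (pawalk_verts u p)"
    if "u \<in> pverts T" "v \<in> pverts T" for u v
    using ex1[OF that] eq by blast
  \<comment> \<open>Every walk can be shortened to the unique path between its ends, so it passes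
    through all vertices of that path.\<close>
  have walk: "path_vertices T u v \<subseteq> set (pawalk_verts u p)" if "awalk u p v" for u p v
  proof -
    have *: "apath u (awalk_to_apath p) v" using apath_awalk_to_apath[OF that] .
    have "set (pawalk_verts u (awalk_to_apath p)) \<subseteq> set (pawalk_verts u p)"
      using set_awalk_verts[OF that] set_awalk_verts[OF awalkI_apath[OF *]]
        awalk_to_apath_subset[OF that] by auto
    then show ?thesis using eq[OF *] by simp
  qed
  show ?thesis
  proof
    fix u v assume uv: "u \<in> pverts T" "v \<in> pverts T"
    obtain p where p: "apath u p v" "path_vertices T u v = set (pawalk_verts u p)"
      using ap[OF uv] by blast
    show "finite (path_vertices T u v)" using p by simp
    show "path_vertices T u v \<subseteq> pverts T" using p by (auto simp: apath_def)
    show "u \<in> path_vertices T u v" using p hd_in_awalk_verts by auto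
    have "apath v (rev_path p) u" using p by simp
    from eq[OF this] show "path_vertices T u v = path_vertices T v u"
      using p(2) awalk_verts_rev_path[OF awalkI_apath[OF p(1)]] by simp
    fix w
    show "path_vertices T u w \<subseteq> path_vertices T u v \<union> path_vertices T v w" if w: "w \<in> pverts T"
    proof -
      obtain q where q: "apath v q w" "path_vertices T v w = set (pawalk_verts v q)"
        using ap uv w by blast
      have "awalk u (p @ q) w" using p q by (auto simp: apath_def intro: awalk_appendI)
      from walk[OF this] show ?thesis
        using set_awalk_verts_append[of u p v q w] p q by (auto simp: apath_def)
    qed
    show "path_vertices T u w \<subseteq> path_vertices T u v
        \<and> path_vertices T u w \<inter> path_vertices T w v = {w}" if w: "w \<in> path_vertices T u v"
    proof -
      have aw: "awalk u p v" using p by (simp add: apath_def)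
      \<comment> \<open>The path is cut at \<open>w\<close>. Both pieces are paths, and since no
        vertex repeats they have only \<open>w\<close> in common.\<close>
      obtain q r where qr: "p = q @ r" "awalk u q w" "awalk w r v"
        using awalk_decomp[OF aw] w p(2) by metis
      have lst: "last (pawalk_verts u q) = w" using qr by auto
      have *: "apath u q w" "apath w r v"
        "set (pawalk_verts u q) \<inter> set (tl (pawalk_verts w r)) = {}"
        using p(1) unfolding qr(1) apath_append_iff lst by auto
      have "hd (pawalk_verts w r) = w" using qr by auto
      then have "set (pawalk_verts w r) = insert w (set (tl (pawalk_verts w r)))"
        by (cases "pawalk_verts w r") (use awalk_verts_non_Nil in auto)
      moreover have "w \<in> set (pawalk_verts u q)" using lst awalk_verts_non_Nil last_in_set by metis
      ultimately show ?thesis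
        using eq[OF *(1)] eq[OF *(2)] *(3) p(2) set_awalk_verts_append[OF qr(2,3)] qr(1) by auto
    qed
    show "w \<in> path_vertices T u v" if w: "w \<in> pverts T"
      and int: "path_vertices T u w \<inter> path_vertices T w v = {w}"
    proof -
      obtain q where q: "apath u q w" "path_vertices T u w = set (pawalk_verts u q)"
        using ap uv w by blast
      obtain r where r: "apath w r v" "path_vertices T w v = set (pawalk_verts w r)"
        using ap uv w by blast
      have qw: "awalk u q w" and rw: "awalk w r v" using q r by (auto simp: apath_def)
      have lst: "last (pawalk_verts u q) = w" using qw by auto
      have hd: "hd (pawalk_verts w r) = w" using rw by auto
      \<comment> \<open>Conversely, two paths meeting only in \<open>w\<close> join without repeated
        vertices, and by uniqueness the result is the path from \<open>u\<close> to
        \<open>v\<close>.\<close>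
      have "w \<notin> set (tl (pawalk_verts w r))"
        using hd r(1) by (cases "pawalk_verts w r") (auto simp: apath_def)
      then have "set (pawalk_verts u q) \<inter> set (tl (pawalk_verts w r)) = {}"
        using int q(2) r(2) by (cases "pawalk_verts w r") auto
      then have "apath u (q @ r) v" unfolding apath_append_iff lst using q r by simp
      then show ?thesis
        using eq set_awalk_verts_append[OF qw rw] hd_in_awalk_verts(1)[OF rw] by auto
    qed
  qed
qed

text \<open>The usual axioms of the quartet relation \<open>ab|cd\<close> of a tree with vertices of
  any degree: symmetries and exclusivity, transitivity, and saturation by a fifth point. They serve
  as necessary conditions that cut the candidates for an amalgamation down to a finite list.\<close>

definition quartic :: "'b set \<Rightarrow> ('b \<Rightarrow> 'b \<Rightarrow> 'b \<Rightarrow> 'b \<Rightarrow> bool) \<Rightarrow> bool" where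
  "quartic A Q \<longleftrightarrow>
     (\<forall>a b c d. Q a b c d \<longrightarrow> {a, b, c, d} \<subseteq> A \<and> distinct [a, b, c, d] \<and>
        Q b a c d \<and> Q c d a b \<and> \<not> Q a c b d) \<and>
     (\<forall>a b c d e. Q a b d e \<longrightarrow> Q b c d e \<longrightarrow> a \<noteq> c \<longrightarrow> Q a c d e) \<and>
     (\<forall>a b c d e. Q a b c d \<longrightarrow> e \<in> A - {a, b, c, d} \<longrightarrow> Q a e c d \<or> Q a b c e)"

context tree_interval
begin

lemma right_in_I: "\<lbrakk>u \<in> V; v \<in> V\<rbrakk> \<Longrightarrow> v \<in> I u v"
  using left_in_I I_commute by blast

lemma I_subset_I:
  assumes "u \<in> V" "v \<in> V" "x \<in> I u v" "y \<in> I u v"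
  shows "I x y \<subseteq> I u v"
proof -
  have V: "x \<in> V" "y \<in> V" using assms I_subset by blast+
  have "I u x \<subseteq> I u v" "I u y \<subseteq> I u v" using I_split assms by blast+
  moreover have "I x y \<subseteq> I x u \<union> I u y" using I_triangle assms V by blast
  ultimately show ?thesis using I_commute assms V by blast
qed

text \<open>\<open>z\<close> is the point of \<open>P\<close> nearest to \<open>e\<close>, measured
  by the number of vertices on the path: another point of \<open>P\<close> on the path from
  \<open>e\<close> to \<open>z\<close> would be strictly nearer.\<close>

lemma I_gate:
  assumes "P \<subseteq> V" "finite P" "P \<noteq> {}" "e \<in> V"
  obtains z where "z \<in> P" "I e z \<inter> P = {z}"
proof -
  obtain z where z: "z \<in> P" "\<And>y. y \<in> P \<Longrightarrow> card (I e z) \<le> card (I e y)"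
    using arg_min_if_finite[OF assms(2,3), of "\<lambda>z. card (I e z)"] by (metis not_le)
  have zV: "z \<in> V" using z assms by blast
  have "y = z" if y: "y \<in> I e z" "y \<in> P" for y
  proof (rule ccontr)
    assume "y \<noteq> z"
    have yV: "y \<in> V" using y assms by blast
    have sp: "I e y \<subseteq> I e z" "I e y \<inter> I y z = {y}" using I_split[OF assms(4) zV y(1)] by blast+
    have "z \<in> I y z" using right_in_I yV zV by blast
    then have "z \<notin> I e y" using sp(2) \<open>y \<noteq> z\<close> by auto
    then have "I e y \<subset> I e z" using sp(1) right_in_I[OF assms(4) zV] by blast
    then have "card (I e y) < card (I e z)" using finite_I[OF assms(4) zV] psubset_card_mono by blast
    then show False using z(2)[OF y(2)] by simp
  qed
  then show thesis using that z(1) right_in_I[OF assms(4) zV] by blast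
qed

lemma quartic_I:
  assumes AV: "A \<subseteq> V"
  shows "quartic A (\<lambda>a b c d. {a, b, c, d} \<subseteq> A \<and> distinct [a, b, c, d] \<and> I a b \<inter> I c d = {})"
proof -
  have excl: "I a c \<inter> I b d \<noteq> {}"
    if V: "a \<in> V" "b \<in> V" "c \<in> V" "d \<in> V" and disj: "I a b \<inter> I c d = {}" for a b c d
  proof -
    \<comment> \<open>\<open>p\<close> is the gate of \<open>c\<close> on the path from
      \<open>a\<close> to \<open>b\<close>. It lies on the path from \<open>a\<close> to
      \<open>c\<close> and, as the path from \<open>c\<close> to \<open>d\<close> avoids that from
      \<open>a\<close> to \<open>b\<close>, also on the path from \<open>b\<close> to
      \<open>d\<close>.\<close>
    obtain p where p: "p \<in> I a b" "I c p \<inter> I a b = {p}"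
      using I_gate[OF I_subset[OF V(1,2)] finite_I[OF V(1,2)] _ V(3)] left_in_I V by blast
    have pV: "p \<in> V" using p(1) I_subset V by blast
    have ap: "I a p \<subseteq> I a b" "I b p \<subseteq> I a b"
      using p(1) I_subset_I V left_in_I right_in_I by blast+
    have pc: "I p c = I c p" using I_commute pV V by blast
    have "I c p \<inter> I a b \<subseteq> {p}" using p(2) by simp
    then have "I a p \<inter> I p c \<subseteq> {p}" unfolding pc using ap(1) by blast
    then have "I a p \<inter> I p c = {p}" using right_in_I[OF V(1) pV] left_in_I[OF pV V(3)] by blast
    then have 1: "p \<in> I a c" using I_join V pV by blast
    have "I p d \<subseteq> I p c \<union> I c d" using I_triangle V pV by blast
    moreover have "I p c \<inter> I a b \<subseteq> {p}" using p(2) unfolding pc by simp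
    ultimately have "I b p \<inter> I p d \<subseteq> {p}" using ap(2) disj by blast
    then have "I b p \<inter> I p d = {p}" using left_in_I[OF pV V(4)] right_in_I[OF V(2) pV] by blast
    then have "p \<in> I b d" using I_join V pV by blast
    with 1 show ?thesis by blast
  qed
  have rel: "I a e \<inter> I c d = {} \<or> I a b \<inter> I c e = {}"
    if V: "a \<in> V" "b \<in> V" "c \<in> V" "d \<in> V" "e \<in> V" and disj: "I a b \<inter> I c d = {}" for a b c d e
  proof -
    \<comment> \<open>The fifth point \<open>e\<close> is attached at its gate \<open>z\<close> on
      the union of the two paths. Whichever path carries \<open>z\<close> can be diverted to
      \<open>e\<close> without meeting the other one.\<close>
    have "I a b \<union> I c d \<subseteq> V" "finite (I a b \<union> I c d)" "I a b \<union> I c d \<noteq> {}"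
      using I_subset finite_I left_in_I V by blast+
    then obtain z where z: "z \<in> I a b \<union> I c d" "I e z \<inter> (I a b \<union> I c d) = {z}"
      using I_gate V(5) by metis
    have zV: "z \<in> V" using z(1) I_subset V by blast
    have ze: "I z e \<inter> (I a b \<union> I c d) = {z}" using z(2) I_commute[OF zV V(5)] by simp
    show ?thesis
    proof (cases "z \<in> I a b")
      case True
      then have "I a z \<subseteq> I a b" using I_split V by blast
      moreover have "I a e \<subseteq> I a z \<union> I z e" using I_triangle V zV by blast
      moreover have "I z e \<inter> I c d = {}" using True ze disj by blast
      ultimately have "I a e \<inter> I c d = {}" using disj by blast
      then show ?thesis ..
    next
      case False
      then have "z \<in> I c d" using z(1) by blast
      then have "I c z \<subseteq> I c d" using I_split V by blast
      moreover have "I c e \<subseteq> I c z \<union> I z e" using I_triangle V zV by blast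
      moreover have "I z e \<inter> I a b \<subseteq> {z}" using ze by auto
      then have "I z e \<inter> I a b = {}" using False by auto
      ultimately have "I a b \<inter> I c e = {}" using disj by blast
      then show ?thesis ..
    qed
  qed
  have tri: "I a c \<inter> I d e = {}"
    if V: "a \<in> V" "b \<in> V" "c \<in> V" and *: "I a b \<inter> I d e = {}" "I b c \<inter> I d e = {}" for a b c d e
    using I_triangle[OF V] * by blast
  have V: "x \<in> V" if "x \<in> A" for x using that AV by blast
  show ?thesis
    unfolding quartic_def
  proof (intro conjI allI impI, goal_cases)
    \<comment> \<open>Cases 5 and 8 are the symmetries, 9 is exclusivity, 12 transitivity and 13
      saturation.\<close>
    case (5 a b c d)
    then show ?case using I_commute[of a b] V by auto
  next
    case (8 a b c d)
    then show ?case by (auto simp: Int_commute)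
  next
    case (9 a b c d)
    then show ?case using excl[of a b c d] V by auto
  next
    case (12 a b c d e)
    then show ?case using tri[of a b c d e] V by simp
  next
    case (13 a b c d e)
    then have "I a e \<inter> I c d = {} \<or> I a b \<inter> I c e = {}" using rel[of a b c d e] V by simp
    then show ?case using 13 by auto
  qed auto
qed

end

lemma quartic_path_vertices:
  assumes "is_tree T"
  shows "quartic (leaves T) (\<lambda>a b c d. {a, b, c, d} \<subseteq> leaves T \<and> distinct [a, b, c, d] \<and>
    path_vertices T a b \<inter> path_vertices T c d = {})"
  by (rule tree_interval.quartic_I[OF tree_interval_path_vertices[OF assms]]) (auto simp: leaves_def)

section \<open>Growing trees leaf by leaf\<close>

definition single_vertex :: "'v \<Rightarrow> 'v pair_pre_digraph" where
  "single_vertex v = \<lparr>pverts = {v}, parcs = {}\<rparr>"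

definition add_leaf :: "'v pair_pre_digraph \<Rightarrow> 'v \<Rightarrow> 'v \<Rightarrow> 'v pair_pre_digraph" where
  "add_leaf T q w = \<lparr>pverts = insert w (pverts T), parcs = insert (w, q) (insert (q, w) (parcs T))\<rparr>"

lemma single_vertex_simps [simp]:
  "pverts (single_vertex v) = {v}" "parcs (single_vertex v) = {}"
  by (simp_all add: single_vertex_def)

lemma add_leaf_simps [simp]:
  "pverts (add_leaf T q w) = insert w (pverts T)"
  "parcs (add_leaf T q w) = insert (w, q) (insert (q, w) (parcs T))"
  by (simp_all add: add_leaf_def)

lemma apath_with_proj_iff:
  "pre_digraph.apath (with_proj T) u p v \<longleftrightarrow>
     u \<in> pverts T \<and> set p \<subseteq> parcs T \<and> pcas u p v \<and> distinct (pawalk_verts u p)"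
  by (auto simp: pre_digraph.apath_def pre_digraph.awalk_def cas_with_proj_eq awalk_verts_with_proj_eq)

lemma is_tree_single_vertex [simp]: "is_tree (single_vertex v)"
proof -
  have "pair_graph (single_vertex v)"
    by unfold_locales (auto simp: symmetric_def sym_def)
  then show ?thesis by (auto simp: is_tree_def apath_with_proj_iff)
qed

lemma path_vertices_eqI:
  assumes "is_tree T" "v \<in> pverts T" "pre_digraph.apath (with_proj T) u p v"
  shows "path_vertices T u v = set (pawalk_verts u p)"
proof -
  have "u \<in> pverts T" using assms(3) by (simp add: apath_with_proj_iff)
  then have "(THE p. pre_digraph.apath (with_proj T) u p v) = p"
    using assms unfolding is_tree_def by blast
  then show ?thesis by (simp add: path_vertices_def)
qed

lemma path_vertices_same [simp]:
  assumes "is_tree T" "v \<in> pverts T"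
  shows "path_vertices T v v = {v}"
  using path_vertices_eqI[OF assms, of v "[]"] assms(2) by (simp add: apath_with_proj_iff)

lemma path_vertices_commute:
  assumes "is_tree T" "u \<in> pverts T" "v \<in> pverts T"
  shows "path_vertices T u v = path_vertices T v u"
  using tree_interval.I_commute[OF tree_interval_path_vertices[OF assms(1)] assms(2,3)] .

context
  fixes T :: "'v pair_pre_digraph" and q w :: 'v
  assumes T: "is_tree T" and q: "q \<in> pverts T" and w: "w \<notin> pverts T"
begin

interpretation pair_graph T using T by (simp add: is_tree_def)

interpretation L: pair_graph "add_leaf T q w"
proof unfold_locales
  show "symmetric (with_proj (add_leaf T q w))"
    using sym_arcs by (auto simp: symmetric_def sym_def)
  show "finite (pverts (add_leaf T q w))" "finite (parcs (add_leaf T q w))"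
    using pair_finite_verts pair_finite_arcs by simp_all
  fix e assume e: "e \<in> parcs (add_leaf T q w)"
  show "fst e \<in> pverts (add_leaf T q w)" "snd e \<in> pverts (add_leaf T q w)"
    using e q arc_fst_in_verts arc_snd_in_verts by auto
  show "fst e \<noteq> snd e" using e q w no_loops' by (cases e) auto
qed

lemma no_arc_new: "(w, x) \<notin> parcs T" "(x, w) \<notin> parcs T"
  using w wellformed' by blast+

text \<open>The new vertex \<open>w\<close> has the single neighbour \<open>q\<close>, so a path
  through \<open>w\<close> with other ends would visit \<open>q\<close> twice.\<close>

lemma add_leaf_apath_old:
  assumes "u \<in> pverts T" "v \<in> pverts T"
  shows "L.apath u p v \<longleftrightarrow> apath u p v"
proof
  assume p: "L.apath u p v"
  have enter: "(x, w) \<notin> set p'" if p': "L.apath u' p' v'" and "v' \<noteq> w" for u' p' v' x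
  proof
    assume x: "(x, w) \<in> set p'"
    obtain p1 z p2 where *: "p' = p1 @ (x, w) # (w, z) # p2" "x \<noteq> z"
      using L.apath_succ_decomp[OF p' x] \<open>v' \<noteq> w\<close> by blast
    then have "(x, w) \<in> parcs (add_leaf T q w)" "(w, z) \<in> parcs (add_leaf T q w)"
      using p' by (auto simp: apath_with_proj_iff)
    then have "x = q" "z = q" using no_arc_new by auto
    then show False using *(2) by simp
  qed
  have "(x, w) \<notin> set p" for x using enter p assms w by metis
  \<comment> \<open>Arcs leaving \<open>w\<close> become arcs entering \<open>w\<close> on the
    reversed path.\<close>
  moreover have "(w, x) \<notin> set p" for x
  proof -
    have "(x, w) \<notin> set (rev_path p)" using enter[of v "rev_path p" u] p assms w by auto
    moreover have "(x, w) \<in> set (rev_path p)" if "(w, x) \<in> set p" for p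
      using that by (induction p) auto
    ultimately show ?thesis by blast
  qed
  ultimately have "set p \<subseteq> parcs T" using p by (auto simp: apath_with_proj_iff)
  then show "apath u p v" using p assms by (simp add: apath_with_proj_iff)
qed (use assms in \<open>auto simp: apath_with_proj_iff\<close>)

lemma add_leaf_apath_new:
  assumes "v \<in> pverts T"
  shows "L.apath w p v \<longleftrightarrow> (\<exists>p'. p = (w, q) # p' \<and> apath q p' v)"
proof
  assume p: "L.apath w p v"
  then obtain e p' where p': "p = e # p'" using assms w by (cases p) (auto simp: apath_with_proj_iff)
  then have "e = (w, q)" "L.apath q p' v"
    using p no_arc_new q w by (cases e; auto simp: L.apath_Cons_iff)+
  then show "\<exists>p'. p = (w, q) # p' \<and> apath q p' v"
    using p' add_leaf_apath_old[OF q assms] by blast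
next
  assume "\<exists>p'. p = (w, q) # p' \<and> apath q p' v"
  then obtain p' where p': "p = (w, q) # p'" "apath q p' v" by blast
  then have "w \<notin> set (pawalk_verts q p')" using w by (auto simp: apath_def)
  then show "L.apath w p v"
    using p' add_leaf_apath_old[OF q assms] by (simp add: L.apath_Cons_iff)
qed

text \<open>Paths starting in the new leaf are paths starting in \<open>q\<close>, preceded by the
  new edge; paths ending there are their reverses.\<close>

lemma is_tree_add_leaf: "is_tree (add_leaf T q w)"
proof -
  have old: "\<exists>!p. apath u p v" if "u \<in> pverts T" "v \<in> pverts T" for u v
    using T that by (simp add: is_tree_def)
  have new: "\<exists>!p. L.apath w p v" if "v \<in> pverts T" for v
    using old[OF q that] add_leaf_apath_new[OF that] by auto
  have new': "\<exists>!p. L.apath v p w" if v: "v \<in> pverts T" for v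
  proof -
    obtain p where p: "L.apath w p v" "\<And>p'. L.apath w p' v \<Longrightarrow> p' = p" using new[OF v] by blast
    show ?thesis
    proof (rule ex1I)
      show "L.apath v (rev_path p) w" using p(1) by simp
      fix p' assume "L.apath v p' w"
      then have "L.apath w (rev_path p') v" by simp
      from p(2)[OF this] show "p' = rev_path p" by (metis rev_path_rev_path)
    qed
  qed
  have self: "\<exists>!p. L.apath w p w"
  proof (rule ex1I)
    show "L.apath w [] w" by (simp add: apath_with_proj_iff)
    fix p assume "L.apath w p w"
    then show "p = []" using L.apath_nonempty_ends by blast
  qed
  show ?thesis
    unfolding is_tree_def
  proof (intro conjI ballI)
    show "pair_graph (add_leaf T q w)" ..
    fix u v assume "u \<in> pverts (add_leaf T q w)" "v \<in> pverts (add_leaf T q w)"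
    then show "\<exists>!p. L.apath u p v"
      using old new new' self add_leaf_apath_old by (cases "u = w"; cases "v = w") auto
  qed
qed

text \<open>A recursion along the construction by leaves, which makes the paths of the concrete
  trees below computable by simplification.\<close>

lemma path_vertices_add_leaf:
  assumes "u \<in> insert w (pverts T)" "v \<in> insert w (pverts T)"
  shows "path_vertices (add_leaf T q w) u v =
    (if u = w then if v = w then {w} else insert w (path_vertices T q v)
     else if v = w then insert w (path_vertices T u q) else path_vertices T u v)"
proof -
  have ap: "\<exists>p. apath u p v" if "u \<in> pverts T" "v \<in> pverts T" for u v
    using T that unfolding is_tree_def by blast
  have old: "path_vertices (add_leaf T q w) u v = path_vertices T u v"
    if uv: "u \<in> pverts T" "v \<in> pverts T" for u v
  proof -
    obtain p where p: "apath u p v" using ap uv by blast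
    have "L.apath u p v" using p add_leaf_apath_old uv by blast
    from path_vertices_eqI[OF is_tree_add_leaf _ this] path_vertices_eqI[OF T uv(2) p] uv
    show ?thesis by simp
  qed
  have new: "path_vertices (add_leaf T q w) w v = insert w (path_vertices T q v)"
    if v: "v \<in> pverts T" for v
  proof -
    obtain p where p: "apath q p v" using ap q v by blast
    have "L.apath w ((w, q) # p) v" using p add_leaf_apath_new[OF v] by blast
    from path_vertices_eqI[OF is_tree_add_leaf _ this] path_vertices_eqI[OF T v p] v
    show ?thesis by simp
  qed
  have new': "path_vertices (add_leaf T q w) v w = insert w (path_vertices T v q)"
    if v: "v \<in> pverts T" for v
    using new[OF v] path_vertices_commute[OF is_tree_add_leaf, of v w] path_vertices_commute[OF T q v] v
    by simp
  show ?thesis using assms old new new' is_tree_add_leaf by auto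
qed

lemma out_degree_add_leaf:
  "out_degree (with_proj (add_leaf T q w)) v =
    (if v = w then 1 else if v = q then Suc (out_degree (with_proj T) v) else out_degree (with_proj T) v)"
proof -
  have "out_arcs (with_proj (add_leaf T q w)) v =
    (if v = w then {(w, q)} else if v = q then insert (q, w) (out_arcs (with_proj T) v)
     else out_arcs (with_proj T) v)"
    using no_arc_new q w by (auto simp: out_arcs_def)
  moreover have "finite (out_arcs (with_proj T) x)" for x
    using pair_finite_arcs by (simp add: out_arcs_def)
  ultimately show ?thesis by (simp add: out_degree_def no_arc_new)
qed

end

lemma out_degree_single_vertex: "out_degree (with_proj (single_vertex v)) u = 0"
  by (simp add: out_degree_def out_arcs_def)

lemmas add_leaf_rules = is_tree_add_leaf path_vertices_add_leaf out_degree_add_leaf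
  out_degree_single_vertex

section \<open>Three trees of maximal degree 3\<close>

definition star3 :: "nat pair_pre_digraph" where
  "star3 = add_leaf (add_leaf (add_leaf (single_vertex 0) 0 1) 0 2) 0 3"

text \<open>The inner edge joins \<open>0\<close> and \<open>1\<close>; the leaves are
  \<open>2\<close>, \<open>3\<close> at \<open>0\<close> and \<open>4\<close>, \<open>5\<close> at
  \<open>1\<close>.\<close>

definition quartet4 :: "nat pair_pre_digraph" where
  "quartet4 = add_leaf (add_leaf (add_leaf (add_leaf (add_leaf (single_vertex 0)
     0 1) 0 2) 0 3) 1 4) 1 5"

text \<open>The inner vertices form the chain \<open>0\<close>, \<open>1\<close>, \<open>2\<close>;
  the cherries \<open>3\<close>, \<open>4\<close> and \<open>6\<close>, \<open>7\<close> hang at its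
  ends and the leaf \<open>5\<close> at its middle.\<close>

definition caterpillar5 :: "nat pair_pre_digraph" where
  "caterpillar5 = add_leaf (add_leaf (add_leaf (add_leaf (add_leaf (add_leaf (add_leaf (single_vertex 0)
     0 1) 1 2) 0 3) 0 4) 1 5) 2 6) 2 7"

lemma is_tree_star3: "is_tree star3"
  and leaves_star3: "leaves star3 = {1, 2, 3}"
  and out_degree_star3: "v \<in> pverts star3 \<Longrightarrow> out_degree (with_proj star3) v \<le> 3"
  by (auto simp: star3_def leaves_def add_leaf_rules split: if_splits)

lemma is_tree_quartet4: "is_tree quartet4"
  and leaves_quartet4: "leaves quartet4 = {2, 3, 4, 5}"
  and out_degree_quartet4: "v \<in> pverts quartet4 \<Longrightarrow> out_degree (with_proj quartet4) v \<le> 3"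
  by (auto simp: quartet4_def leaves_def add_leaf_rules split: if_splits)

lemma is_tree_caterpillar5: "is_tree caterpillar5"
  and leaves_caterpillar5: "leaves caterpillar5 = {3, 4, 5, 6, 7}"
  and out_degree_caterpillar5: "v \<in> pverts caterpillar5 \<Longrightarrow> out_degree (with_proj caterpillar5) v \<le> 3"
  by (auto simp: caterpillar5_def leaves_def add_leaf_rules split: if_splits)

lemma path_vertices_quartet4:
  "path_vertices quartet4 2 3 = {2, 0, 3}" "path_vertices quartet4 4 5 = {4, 1, 5}"
  "path_vertices quartet4 2 4 = {2, 0, 1, 4}" "path_vertices quartet4 2 5 = {2, 0, 1, 5}"
  "path_vertices quartet4 3 4 = {3, 0, 1, 4}" "path_vertices quartet4 3 5 = {3, 0, 1, 5}"
  by (auto simp: quartet4_def add_leaf_rules)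

lemma path_vertices_caterpillar5:
  "path_vertices caterpillar5 3 4 = {3, 0, 4}" "path_vertices caterpillar5 6 7 = {6, 2, 7}"
  "path_vertices caterpillar5 3 5 = {3, 0, 1, 5}" "path_vertices caterpillar5 4 5 = {4, 0, 1, 5}"
  "path_vertices caterpillar5 3 6 = {3, 0, 1, 2, 6}" "path_vertices caterpillar5 3 7 = {3, 0, 1, 2, 7}"
  "path_vertices caterpillar5 4 6 = {4, 0, 1, 2, 6}" "path_vertices caterpillar5 4 7 = {4, 0, 1, 2, 7}"
  "path_vertices caterpillar5 5 6 = {5, 1, 2, 6}" "path_vertices caterpillar5 5 7 = {5, 1, 2, 7}"
  by (auto simp: caterpillar5_def add_leaf_rules)

section \<open>Structures given by a colouring and a quartic relation\<close>

definition qstruct ::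
  "'b set \<Rightarrow> ('b \<Rightarrow> nat) \<Rightarrow> ('b \<Rightarrow> 'b \<Rightarrow> 'b \<Rightarrow> 'b \<Rightarrow> bool) \<Rightarrow> ('b, tree_sym) rstruct" where
  "qstruct A \<sigma> Q = \<lparr>pts = A, rel = (\<lambda>s. case s of
       Quartic \<Rightarrow> {[a, b, c, d] | a b c d. Q a b c d}
     | Color c \<Rightarrow> {[a] | a. a \<in> A \<and> \<sigma> a = c})\<rparr>"

text \<open>The symmetries alone. They suffice for comparing relations and describing maps, and they
  hold for every \<open>split_quartic\<close> below, whether or not the splits belong to a
  tree.\<close>

definition qsym :: "'b set \<Rightarrow> ('b \<Rightarrow> 'b \<Rightarrow> 'b \<Rightarrow> 'b \<Rightarrow> bool) \<Rightarrow> bool" where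
  "qsym A Q \<longleftrightarrow> (\<forall>a b c d. Q a b c d \<longrightarrow>
     {a, b, c, d} \<subseteq> A \<and> distinct [a, b, c, d] \<and> Q b a c d \<and> Q c d a b)"

lemma qsymD:
  assumes "qsym A Q" "Q a b c d"
  shows "a \<in> A" "b \<in> A" "c \<in> A" "d \<in> A" "distinct [a, b, c, d]" "Q b a c d" "Q c d a b"
  using assms unfolding qsym_def by blast+

lemma qsym_quartic: "quartic A Q \<Longrightarrow> qsym A Q"
  unfolding quartic_def qsym_def by blast

lemma quartic_exclusive: "\<lbrakk>quartic A Q; Q a b c d\<rbrakk> \<Longrightarrow> \<not> Q a c b d"
  and quartic_trans: "\<lbrakk>quartic A Q; Q a b d e; Q b c d e; a \<noteq> c\<rbrakk> \<Longrightarrow> Q a c d e"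
  and quartic_extend: "\<lbrakk>quartic A Q; Q a b c d; e \<in> A; e \<notin> {a, b, c, d}\<rbrakk> \<Longrightarrow> Q a e c d \<or> Q a b c e"
  unfolding quartic_def by blast+

lemma qsym_sym:
  assumes "qsym A Q"
  shows "Q b a c d = Q a b c d" "Q c d a b = Q a b c d" "Q a b d c = Q a b c d"
  using qsymD(6,7)[OF assms] by blast+

text \<open>Up to the symmetries a quadruple of distinct points is one of three pairings of a
  four-element set, and five points have five such sets. This leaves fifteen comparisons.\<close>

lemma qsym_eqI5:
  assumes Q: "qsym A Q" and R: "qsym A R" and A: "A = {p, q, r, s, t}"
    and eq: "\<And>a b c d. (a, b, c, d) \<in> {(p, q, r, s), (p, q, r, t), (p, q, s, t), (p, r, s, t), (q, r, s, t)}
      \<Longrightarrow> Q a b c d = R a b c d \<and> Q a c b d = R a c b d \<and> Q a d b c = R a d b c"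
  shows "Q = R"
proof -
  define E where "E a b c d \<longleftrightarrow> Q a b c d = R a b c d \<and> Q a c b d = R a c b d \<and> Q a d b c = R a d b c"
    for a b c d
  \<comment> \<open>\<open>E\<close> collects all three pairings of a set, so it is invariant under
    every permutation.\<close>
  have E_sym: "E b a c d = E a b c d" "E a c b d = E a b c d" "E a b d c = E a b c d" for a b c d
    unfolding E_def using qsym_sym[OF Q] qsym_sym[OF R] by metis+
  have E5: "E p q r s" "E p q r t" "E p q s t" "E p r s t" "E q r s t"
    unfolding E_def by (rule eq; simp)+
  show ?thesis
  proof (intro ext)
    fix a b c d
    show "Q a b c d = R a b c d"
    proof (cases "{a, b, c, d} \<subseteq> A \<and> distinct [a, b, c, d]")
      case True
      then have "a \<in> {p, q, r, s, t}" "b \<in> {p, q, r, s, t}" "c \<in> {p, q, r, s, t}" "d \<in> {p, q, r, s, t}"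
        "a \<noteq> b" "a \<noteq> c" "a \<noteq> d" "b \<noteq> c" "b \<noteq> d" "c \<noteq> d"
        unfolding A by auto
      then have "E a b c d"
        by (elim insertE emptyE) (simp_all only: E_sym E5 simp_thms)
      then show ?thesis by (simp add: E_def)
    next
      case False
      then show ?thesis using qsymD[OF Q, of a b c d] qsymD[OF R, of a b c d] by auto
    qed
  qed
qed

lemma qsym_eqI4:
  assumes "qsym {p, q, r, s} Q" "qsym {p, q, r, s} R"
    and "Q p q r s = R p q r s" "Q p r q s = R p r q s" "Q p s q r = R p s q r"
  shows "Q = R"
proof -
  have ndist: "\<not> Q a b c d" "\<not> R a b c d" if "\<not> distinct [a, b, c, d]" for a b c d
    using qsymD(5)[OF assms(1)] qsymD(5)[OF assms(2)] that by blast+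
  show ?thesis
  \<comment> \<open>The fifth point repeats \<open>s\<close>; quadruples with a repetition belong to
    neither relation.\<close>
  proof (rule qsym_eqI5[of _ _ _ p q r s s])
    fix a b c d
    assume "(a, b, c, d) \<in> {(p, q, r, s), (p, q, r, s), (p, q, s, s), (p, r, s, s), (q, r, s, s)}"
    then show "Q a b c d = R a b c d \<and> Q a c b d = R a c b d \<and> Q a d b c = R a d b c"
      using assms(3-5) ndist by auto
  qed (use assms in auto)
qed

lemma pts_qstruct [simp]: "pts (qstruct A \<sigma> Q) = A"
  by (simp add: qstruct_def)

lemma rel_qstruct_Quartic [simp]: "[a, b, c, d] \<in> rel (qstruct A \<sigma> Q) Quartic \<longleftrightarrow> Q a b c d"
  by (simp add: qstruct_def)

lemma rel_qstruct_Color [simp]: "[a] \<in> rel (qstruct A \<sigma> Q) (Color c) \<longleftrightarrow> a \<in> A \<and> \<sigma> a = c"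
  by (simp add: qstruct_def)

lemma is_structure_qstruct:
  assumes "qsym A Q"
  shows "is_structure (qstruct A \<sigma> Q)"
  using qsymD(1-4)[OF assms] unfolding is_structure_def qstruct_def by (auto split: tree_sym.split)

lemma qstruct_inject: "qstruct A \<sigma> Q = qstruct A \<tau> R \<Longrightarrow> Q = R"
  by (intro ext) (metis rel_qstruct_Quartic)

section \<open>Isomorphisms, embeddings and transport of structure\<close>

lemma map_rel_qstruct_iff:
  assumes Q: "qsym A Q" and R: "qsym B R" and f: "f \<in> A \<rightarrow> B"
  shows "(\<forall>s. \<forall>xs \<in> lists A. xs \<in> rel (qstruct A \<sigma> Q) s \<longleftrightarrow> map f xs \<in> rel (qstruct B \<tau> R) s) \<longleftrightarrow>
     (\<forall>a\<in>A. \<sigma> a = \<tau> (f a)) \<and>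
     (\<forall>a\<in>A. \<forall>b\<in>A. \<forall>c\<in>A. \<forall>d\<in>A. Q a b c d = R (f a) (f b) (f c) (f d))" (is "?L \<longleftrightarrow> ?C \<and> ?Q")
proof
  assume L: ?L
  have ?C
  proof
    fix a assume a: "a \<in> A"
    then have "[a] \<in> lists A" by simp
    with L have "[a] \<in> rel (qstruct A \<sigma> Q) (Color (\<sigma> a)) \<longleftrightarrow>
      map f [a] \<in> rel (qstruct B \<tau> R) (Color (\<sigma> a))" by blast
    then show "\<sigma> a = \<tau> (f a)" using a by simp
  qed
  moreover have ?Q
  proof (intro ballI)
    fix a b c d assume "a \<in> A" "b \<in> A" "c \<in> A" "d \<in> A"
    then have "[a, b, c, d] \<in> lists A" by simp
    with L have "[a, b, c, d] \<in> rel (qstruct A \<sigma> Q) Quartic \<longleftrightarrow>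
      map f [a, b, c, d] \<in> rel (qstruct B \<tau> R) Quartic" by blast
    then show "Q a b c d = R (f a) (f b) (f c) (f d)" by simp
  qed
  ultimately show "?C \<and> ?Q" by blast
next
  assume CQ: "?C \<and> ?Q"
  show ?L
  proof (intro allI ballI)
    fix s xs assume xs: "xs \<in> lists A"
    show "xs \<in> rel (qstruct A \<sigma> Q) s \<longleftrightarrow> map f xs \<in> rel (qstruct B \<tau> R) s"
    proof (cases s)
      case Quartic
      show ?thesis
      proof (cases "length xs = 4")
        case True
        then obtain a b c d where "xs = [a, b, c, d]"
          by (auto simp: numeral_eq_Suc length_Suc_conv)
        then show ?thesis using xs CQ Quartic by simp
      qed (auto simp: Quartic qstruct_def)
    next
      case (Color c)
      show ?thesis
      proof (cases "length xs = 1")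
        case True
        then obtain a where "xs = [a]" by (auto simp: length_Suc_conv)
        then show ?thesis using xs CQ Color f by auto
      qed (auto simp: Color qstruct_def)
    qed
  qed
qed

lemma iso_map_qstruct:
  assumes "qsym A Q" "qsym B R"
  shows "iso_map (qstruct A \<sigma> Q) (qstruct B \<tau> R) f \<longleftrightarrow>
     f \<in> extensional A \<and> bij_betw f A B \<and> (\<forall>a\<in>A. \<sigma> a = \<tau> (f a)) \<and>
     (\<forall>a\<in>A. \<forall>b\<in>A. \<forall>c\<in>A. \<forall>d\<in>A. Q a b c d = R (f a) (f b) (f c) (f d))"
proof (cases "bij_betw f A B")
  case True
  then have "f \<in> A \<rightarrow> B" by (auto simp: bij_betw_def)
  from map_rel_qstruct_iff[OF assms this] show ?thesis by (simp add: iso_map_def True)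
qed (simp add: iso_map_def)

lemma embedding_iff:
  "embedding X Y f \<longleftrightarrow> f \<in> pts X \<rightarrow>\<^sub>E pts Y \<and> inj_on f (pts X) \<and>
     (\<forall>s. \<forall>xs \<in> lists (pts X). xs \<in> rel X s \<longleftrightarrow> map f xs \<in> rel Y s)"
proof -
  have "map f xs \<in> lists (f ` pts X)" if "xs \<in> lists (pts X)" for xs
    using that by auto
  then show ?thesis
    unfolding embedding_def iso_map_def induced_def
    by (auto simp: PiE_def bij_betw_def simp del: in_lists_conv_set)
qed

lemma embedding_qstruct:
  assumes "qsym A Q" "qsym B R"
  shows "embedding (qstruct A \<sigma> Q) (qstruct B \<tau> R) f \<longleftrightarrow>
     f \<in> A \<rightarrow>\<^sub>E B \<and> inj_on f A \<and> (\<forall>a\<in>A. \<sigma> a = \<tau> (f a)) \<and>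
     (\<forall>a\<in>A. \<forall>b\<in>A. \<forall>c\<in>A. \<forall>d\<in>A. Q a b c d = R (f a) (f b) (f c) (f d))"
proof (cases "f \<in> A \<rightarrow>\<^sub>E B")
  case True
  then have "f \<in> A \<rightarrow> B" by (auto simp: PiE_def)
  from map_rel_qstruct_iff[OF assms this] show ?thesis by (simp add: embedding_iff True)
qed (simp add: embedding_iff)

lemma iso_map_imp_embedding: "iso_map X Y f \<Longrightarrow> embedding X Y f"
  unfolding embedding_iff iso_map_def by (auto simp: PiE_def bij_betw_def)

lemma iso_map_inverse:
  assumes f: "iso_map X Y f"
  shows "iso_map Y X (\<lambda>y\<in>pts Y. inv_into (pts X) f y)"
proof -
  let ?g = "\<lambda>y\<in>pts Y. inv_into (pts X) f y"
  have bij: "bij_betw f (pts X) (pts Y)" using f by (simp add: iso_map_def)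
  have g: "bij_betw ?g (pts Y) (pts X)"
    using bij_betw_inv_into[OF bij] by (subst bij_betw_restrict_eq)
  have "ys \<in> rel Y s \<longleftrightarrow> map ?g ys \<in> rel X s" if ys: "ys \<in> lists (pts Y)" for ys s
  proof -
    have "map ?g ys \<in> lists (pts X)" using ys bij by (auto simp: bij_betw_def intro!: inv_into_into)
    moreover have "map f (map ?g ys) = ys"
      using ys bij by (auto simp: bij_betw_inv_into_right intro!: map_idI)
    ultimately show ?thesis using f unfolding iso_map_def by metis
  qed
  then show ?thesis using g by (simp add: iso_map_def)
qed

lemma iso_map_compose:
  assumes f: "iso_map X Y f" and g: "iso_map Y Z g"
  shows "iso_map X Z (compose (pts X) g f)"
proof -
  have "bij_betw (compose (pts X) g f) (pts X) (pts Z)"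
    using f g bij_betw_compose by (auto simp: iso_map_def)
  moreover have "xs \<in> rel X s \<longleftrightarrow> map (compose (pts X) g f) xs \<in> rel Z s"
    if xs: "xs \<in> lists (pts X)" for xs s
  proof -
    have "map (compose (pts X) g f) xs = map g (map f xs)" using xs by (auto simp: compose_def)
    moreover have "map f xs \<in> lists (pts Y)" using xs f bij_betwE by (fastforce simp: iso_map_def)
    ultimately show ?thesis using xs f g unfolding iso_map_def by metis
  qed
  ultimately show ?thesis by (simp add: iso_map_def compose_extensional)
qed

lemma isomorphic_trans: "\<lbrakk>isomorphic X Y; isomorphic Y Z\<rbrakk> \<Longrightarrow> isomorphic X Z"
  unfolding isomorphic_def using iso_map_compose by blast

text \<open>Transport of structure: the source and the map determine every relation of the target.
  This turns isomorphism along a common map into equality, both for members of the classes and for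
  amalgamations.\<close>

lemma iso_map_image_eq:
  assumes "iso_map Z B f" "iso_map Z B' f" "is_structure B" "is_structure B'"
  shows "B = B'"
proof -
  have rel: "rel C s = {map f xs | xs. xs \<in> lists (pts Z) \<and> xs \<in> rel Z s}"
    if "iso_map Z C f" "is_structure C" for C s
  proof -
    have "\<exists>xs \<in> lists (pts Z). ys = map f xs" if "ys \<in> rel C s" for ys
    proof -
      have "ys \<in> lists (f ` pts Z)"
        using that \<open>iso_map Z C f\<close> \<open>is_structure C\<close> by (auto simp: is_structure_def iso_map_def bij_betw_def)
      then show ?thesis by (auto simp: lists_image)
    qed
    then show ?thesis using \<open>iso_map Z C f\<close> unfolding iso_map_def by blast
  qed
  have "pts B = pts B'" using assms by (auto simp: iso_map_def bij_betw_def)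
  moreover have "rel B = rel B'" using rel assms by (intro ext) simp
  ultimately show ?thesis by simp
qed

text \<open>Injectivity preserves the inequalities in the axioms. The lemma supplies the relation on
  any copy of a tree and on the point set of an amalgamation.\<close>

lemma quartic_pullback:
  assumes R: "quartic B R" and f: "inj_on f A" "f ` A \<subseteq> B"
  shows "quartic A (\<lambda>a b c d. {a, b, c, d} \<subseteq> A \<and> R (f a) (f b) (f c) (f d))"
    (is "quartic A ?Q")
proof -
  note sym = qsymD[OF qsym_quartic[OF R]]
  have ax1: "distinct [a, b, c, d] \<and> ?Q b a c d \<and> ?Q c d a b \<and> \<not> ?Q a c b d" if "?Q a b c d" for a b c d
    using that sym[of "f a" "f b" "f c" "f d"] quartic_exclusive[OF R, of "f a" "f b" "f c" "f d"] by auto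
  have ax2: "?Q a c d e" if "?Q a b d e" "?Q b c d e" "a \<noteq> c" for a b c d e
    using that quartic_trans[OF R, of "f a" "f b" "f d" "f e" "f c"] f(1) by (auto dest: inj_onD)
  have ax3: "?Q a e c d \<or> ?Q a b c e" if "?Q a b c d" "e \<in> A - {a, b, c, d}" for a b c d e
  proof -
    have "f e \<in> B" using that f by blast
    moreover have "f e \<notin> {f a, f b, f c, f d}" using that f(1) by (auto dest: inj_onD)
    ultimately show ?thesis using that quartic_extend[OF R, of "f a" "f b" "f c" "f d" "f e"] by simp
  qed
  show ?thesis
    unfolding quartic_def
  proof (intro conjI, goal_cases)
    case 1
    show ?case
    proof (intro allI impI)
      fix a b c d assume Q: "?Q a b c d"
      show "{a, b, c, d} \<subseteq> A \<and> distinct [a, b, c, d] \<and> ?Q b a c d \<and> ?Q c d a b \<and> \<not> ?Q a c b d"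
        using Q ax1[OF Q] by blast
    qed
  next
    case 2
    show ?case by (intro allI impI) (rule ax2)
  next
    case 3
    show ?case by (intro allI impI) (rule ax3)
  qed
qed

section \<open>Trees given by splits, and the interface to the two classes\<close>

lemma tree_structure_eq_qstruct:
  "tree_structure T \<sigma> = qstruct (leaves T) \<sigma> (\<lambda>a b c d. {a, b, c, d} \<subseteq> leaves T \<and>
     distinct [a, b, c, d] \<and> path_vertices T a b \<inter> path_vertices T c d = {})"
  unfolding tree_structure_def qstruct_def by (simp only:)

text \<open>A tree is encoded by the bipartitions of its leaves at the inner edges, each listed
  through one side \<open>U\<close>; \<open>ab|cd\<close> holds when some inner edge separates
  \<open>a\<close>, \<open>b\<close> from \<open>c\<close>, \<open>d\<close>. No split gives the
  star, one pair among four leaves the quartet, two disjoint pairs among five leaves the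
  caterpillar.\<close>

definition split_quartic :: "'b set \<Rightarrow> 'b set set \<Rightarrow> 'b \<Rightarrow> 'b \<Rightarrow> 'b \<Rightarrow> 'b \<Rightarrow> bool" where
  "split_quartic A \<U> a b c d \<longleftrightarrow> {a, b, c, d} \<subseteq> A \<and> distinct [a, b, c, d] \<and>
     (\<exists>U\<in>\<U>. a \<in> U \<and> b \<in> U \<and> c \<notin> U \<and> d \<notin> U \<or> a \<notin> U \<and> b \<notin> U \<and> c \<in> U \<and> d \<in> U)"

lemma qsym_split_quartic: "qsym A (split_quartic A \<U>)"
  unfolding qsym_def split_quartic_def by auto

definition split_struct :: "'b set \<Rightarrow> ('b \<Rightarrow> nat) \<Rightarrow> 'b set set \<Rightarrow> ('b, tree_sym) rstruct" where
  "split_struct A \<sigma> \<U> = qstruct A \<sigma> (split_quartic A \<U>)"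

text \<open>All that is used of the two classes. Only trees with degrees at most 3 and colours 1 and
  2 are required as members; membership of other trees is left open, so bounded and unbounded degree
  are treated together.\<close>

locale tree_class =
  fixes F :: "('a, tree_sym) rstruct set"
  assumes iso_closed: "\<lbrakk>Z \<in> F; is_structure Z'; isomorphic Z' Z\<rbrakk> \<Longrightarrow> Z' \<in> F"
    and is_qstruct: "Z \<in> F \<Longrightarrow> \<exists>\<sigma> Q. Z = qstruct (pts Z) \<sigma> Q \<and> quartic (pts Z) Q"
    and star3_in: "\<lbrakk>distinct [a, b, c]; \<sigma> ` {a, b, c} \<subseteq> {1, 2}\<rbrakk> \<Longrightarrow> split_struct {a, b, c} \<sigma> {} \<in> F"
    and quartet4_in: "\<lbrakk>distinct [a, b, c, d]; \<sigma> ` {a, b, c, d} \<subseteq> {1, 2}\<rbrakk> \<Longrightarrow>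
      split_struct {a, b, c, d} \<sigma> {{a, b}} \<in> F"
    and caterpillar5_in: "\<lbrakk>distinct [a, b, m, c, d]; \<sigma> ` {a, b, m, c, d} \<subseteq> {1, 2}\<rbrakk> \<Longrightarrow>
      split_struct {a, b, m, c, d} \<sigma> {{a, b}, {c, d}} \<in> F"

lemma isomorphic_tree_structure:
  assumes f: "bij_betw f A (leaves T)" and T: "is_tree T" and Q: "qsym A Q"
    and eq: "Q = (\<lambda>a b c d. {a, b, c, d} \<subseteq> A \<and> distinct [f a, f b, f c, f d] \<and>
      path_vertices T (f a) (f b) \<inter> path_vertices T (f c) (f d) = {})"
  shows "isomorphic (qstruct A \<sigma> Q) (tree_structure T (\<sigma> \<circ> inv_into A f))"
proof -
  have "iso_map (qstruct A \<sigma> Q) (tree_structure T (\<sigma> \<circ> inv_into A f)) (restrict f A)"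
    unfolding tree_structure_eq_qstruct iso_map_qstruct[OF Q qsym_quartic[OF quartic_path_vertices[OF T]]]
  proof (intro conjI ballI)
    show "bij_betw (restrict f A) A (leaves T)" using f by (subst bij_betw_restrict_eq)
    show "\<sigma> a = (\<sigma> \<circ> inv_into A f) (restrict f A a)" if "a \<in> A" for a
      using that f by (simp add: bij_betw_inv_into_left)
  qed (use f in \<open>auto simp: eq bij_betw_def\<close>)
  then show ?thesis unfolding isomorphic_def by blast
qed

text \<open>\<open>P\<close> is the condition on degrees; it is trivial for the unbounded
  class.\<close>

lemma tree_class_trees:
  fixes F :: "('a, tree_sym) rstruct set"
  assumes F: "F = {X. is_structure X \<and> (\<exists>(T :: nat pair_pre_digraph) \<sigma>. is_tree T \<and> P T \<and>
      \<sigma> \<in> leaves T \<rightarrow> {1..n} \<and> isomorphic X (tree_structure T \<sigma>))}"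
    and P: "P star3" "P quartet4" "P caterpillar5" and n: "n \<ge> 2"
  shows "tree_class F"
proof -
  have memI: "qstruct A \<sigma> Q \<in> F"
    if f: "bij_betw f A (leaves T)" and T: "is_tree T" "P T" and Q: "qsym A Q" and \<sigma>: "\<sigma> ` A \<subseteq> {1, 2}"
      and eq: "Q = (\<lambda>a b c d. {a, b, c, d} \<subseteq> A \<and> distinct [f a, f b, f c, f d] \<and>
        path_vertices T (f a) (f b) \<inter> path_vertices T (f c) (f d) = {})"
    for f and A :: "'a set" and T and \<sigma> Q
  proof -
    have "\<sigma> \<circ> inv_into A f \<in> leaves T \<rightarrow> {1..n}"
    proof
      fix v assume "v \<in> leaves T"
      then have "inv_into A f v \<in> A" using f by (metis bij_betw_def inv_into_into)
      then have "\<sigma> (inv_into A f v) \<in> {1, 2}" using \<sigma> by blast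
      then show "(\<sigma> \<circ> inv_into A f) v \<in> {1..n}" using n by auto
    qed
    then show ?thesis
      unfolding F using isomorphic_tree_structure[OF f T(1) Q eq] is_structure_qstruct[OF Q] T by blast
  qed
  have pull: "qsym A (\<lambda>a b c d. {a, b, c, d} \<subseteq> A \<and> distinct [f a, f b, f c, f d] \<and>
      path_vertices T (f a) (f b) \<inter> path_vertices T (f c) (f d) = {})"
    if f: "bij_betw f A (leaves T)" and T: "is_tree T" for f and A :: "'a set" and T :: "nat pair_pre_digraph"
  proof -
    have "inj_on f A" "f ` A = leaves T" using f by (auto simp: bij_betw_def)
    then have "qsym A (\<lambda>a b c d. {a, b, c, d} \<subseteq> A \<and> {f a, f b, f c, f d} \<subseteq> leaves T \<and>
      distinct [f a, f b, f c, f d] \<and> path_vertices T (f a) (f b) \<inter> path_vertices T (f c) (f d) = {})"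
      using qsym_quartic[OF quartic_pullback[OF quartic_path_vertices[OF T], of f A]] by simp
    moreover have "{f a, f b, f c, f d} \<subseteq> leaves T" if "{a, b, c, d} \<subseteq> A" for a b c d
      using that \<open>f ` A = leaves T\<close> by blast
    ultimately show ?thesis by (simp add: cong: conj_cong)
  qed
  show ?thesis
  proof
    show "Z' \<in> F" if "Z \<in> F" "is_structure Z'" "isomorphic Z' Z" for Z Z'
      using that isomorphic_trans unfolding F by blast
    show "\<exists>\<sigma> Q. Z = qstruct (pts Z) \<sigma> Q \<and> quartic (pts Z) Q" if "Z \<in> F" for Z
    proof -
      obtain T :: "nat pair_pre_digraph" and \<sigma> f where T: "is_tree T" and Z: "is_structure Z"
        and f: "iso_map Z (tree_structure T \<sigma>) f"
        using \<open>Z \<in> F\<close> unfolding F isomorphic_def by blast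
      define R where "R = (\<lambda>a b c d. {a, b, c, d} \<subseteq> leaves T \<and>
        distinct [a, b, c, d] \<and> path_vertices T a b \<inter> path_vertices T c d = {})"
      have R: "quartic (leaves T) R" unfolding R_def by (rule quartic_path_vertices[OF T])
      have TR: "tree_structure T \<sigma> = qstruct (leaves T) \<sigma> R"
        unfolding R_def by (rule tree_structure_eq_qstruct)
      have bij: "inj_on f (pts Z)" "f ` pts Z = leaves T"
        using f unfolding TR by (auto simp: iso_map_def bij_betw_def)
      define Q where "Q = (\<lambda>a b c d. {a, b, c, d} \<subseteq> pts Z \<and> R (f a) (f b) (f c) (f d))"
      have Q: "quartic (pts Z) Q" unfolding Q_def using quartic_pullback[OF R bij(1)] bij(2) by simp
      have "iso_map (qstruct (pts Z) (\<sigma> \<circ> f) Q) (qstruct (leaves T) \<sigma> R) f"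
        unfolding iso_map_qstruct[OF qsym_quartic[OF Q] qsym_quartic[OF R]]
        using f bij by (auto simp: iso_map_def bij_betw_def Q_def)
      \<comment> \<open>Both \<open>Z\<close> and the structure built from \<open>Q\<close> are
        targets of the inverse of \<open>f\<close>, hence equal.\<close>
      from iso_map_inverse[OF this] iso_map_inverse[OF f]
      have "Z = qstruct (pts Z) (\<sigma> \<circ> f) Q"
        unfolding TR pts_qstruct
        using iso_map_image_eq Z is_structure_qstruct[OF qsym_quartic[OF Q]] by blast
      then show ?thesis using Q by blast
    qed
    show "split_struct {a, b, c} \<sigma> {} \<in> F" if d: "distinct [a, b, c]" and \<sigma>: "\<sigma> ` {a, b, c} \<subseteq> {1, 2}"
      for a b c :: 'a and \<sigma>
    proof -
      let ?f = "(\<lambda>_. 0)(a := 1, b := 2, c := 3) :: 'a \<Rightarrow> nat"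
      have f: "bij_betw ?f {a, b, c} (leaves star3)"
        using d by (auto simp: leaves_star3 bij_betw_def inj_on_def)
      show ?thesis
        unfolding split_struct_def
      proof (rule memI[OF f is_tree_star3 P(1) qsym_split_quartic \<sigma>])
        show "split_quartic {a, b, c} {} = (\<lambda>x y z w. {x, y, z, w} \<subseteq> {a, b, c} \<and>
          distinct [?f x, ?f y, ?f z, ?f w] \<and>
          path_vertices star3 (?f x) (?f y) \<inter> path_vertices star3 (?f z) (?f w) = {})"
          by (intro ext) (auto simp: split_quartic_def)
      qed
    qed
    show "split_struct {a, b, c, d} \<sigma> {{a, b}} \<in> F"
      if d: "distinct [a, b, c, d]" and \<sigma>: "\<sigma> ` {a, b, c, d} \<subseteq> {1, 2}" for a b c d :: 'a and \<sigma>
    proof -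
      let ?f = "(\<lambda>_. 0)(a := 2, b := 3, c := 4, d := 5) :: 'a \<Rightarrow> nat"
      have f: "bij_betw ?f {a, b, c, d} (leaves quartet4)"
        using d by (auto simp: leaves_quartet4 bij_betw_def inj_on_def)
      show ?thesis
        unfolding split_struct_def
        by (rule memI[OF f is_tree_quartet4 P(2) qsym_split_quartic \<sigma>],
            rule qsym_eqI4[OF qsym_split_quartic pull[OF f is_tree_quartet4]])
          (use d in \<open>auto simp: split_quartic_def path_vertices_quartet4\<close>)
    qed
    show "split_struct {a, b, m, c, d} \<sigma> {{a, b}, {c, d}} \<in> F"
      if d: "distinct [a, b, m, c, d]" and \<sigma>: "\<sigma> ` {a, b, m, c, d} \<subseteq> {1, 2}" for a b m c d :: 'a and \<sigma>
    proof -
      have d': "distinct [d, c, m, b, a]" using d by auto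
      let ?f = "(\<lambda>_. 0)(a := 3, b := 4, m := 5, c := 6, d := 7) :: 'a \<Rightarrow> nat"
      have f: "bij_betw ?f {a, b, m, c, d} (leaves caterpillar5)"
        using d by (auto simp: leaves_caterpillar5 bij_betw_def inj_on_def)
      show ?thesis
        unfolding split_struct_def
        by (rule memI[OF f is_tree_caterpillar5 P(3) qsym_split_quartic \<sigma>],
            rule qsym_eqI5[OF qsym_split_quartic pull[OF f is_tree_caterpillar5] refl])
          (elim insertE emptyE Pair_inject; use d d' in \<open>simp add: split_quartic_def path_vertices_caterpillar5\<close>)
    qed
  qed
qed

lemma tree_class_colored_trees:
  assumes "n \<ge> 2"
  shows "tree_class (colored_trees n)"
  by (rule tree_class_trees[where P = "\<lambda>_. True" and n = n]) (use assms in \<open>auto simp: colored_trees_def\<close>)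

lemma tree_class_colored_trees_deg:
  assumes "n \<ge> 2" "k \<ge> 3"
  shows "tree_class (colored_trees_deg n k)"
  by (rule tree_class_trees[where P = "\<lambda>T. \<forall>v \<in> pverts T. out_degree (with_proj T) v \<le> k" and n = n])
    (use assms out_degree_star3 out_degree_quartet4 out_degree_caterpillar5 in
      \<open>auto simp: colored_trees_deg_def intro: order_trans\<close>)

section \<open>Amalgamations with a one-point extension\<close>

definition restr :: "'b set \<Rightarrow> ('b \<Rightarrow> 'b \<Rightarrow> 'b \<Rightarrow> 'b \<Rightarrow> bool) \<Rightarrow> 'b \<Rightarrow> 'b \<Rightarrow> 'b \<Rightarrow> 'b \<Rightarrow> bool" where
  "restr A R a b c d \<longleftrightarrow> {a, b, c, d} \<subseteq> A \<and> R a b c d"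

lemma qsym_restr: "qsym B R \<Longrightarrow> qsym A (restr A R)"
  unfolding qsym_def restr_def by blast

abbreviation incl :: "'b set \<Rightarrow> 'b \<Rightarrow> 'b" where
  "incl A \<equiv> restrict (\<lambda>a. a) A"

lemma embedding_incl:
  assumes "qsym B R" "A \<subseteq> B"
  shows "embedding (qstruct A \<sigma> (restr A R)) (qstruct B \<sigma> R) (incl A)"
  unfolding embedding_qstruct[OF qsym_restr[OF assms(1)] assms(1)]
  using assms(2) by (auto simp: restr_def inj_on_def)

text \<open>Joint surjectivity makes an equivalence unique once the maps are given, so the same
  bijection carries \<open>Z\<close> to \<open>B\<close> and to \<open>B'\<close>.\<close>

lemma amalg_equiv_functional:
  assumes "amalg_equiv X Y (Z, j, i) (B, j', i')" "amalg_equiv X Y (Z, j, i) (B', j', i')"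
    and Z: "pts Z = j ` pts X \<union> i ` pts Y" and "is_structure B" "is_structure B'"
  shows "B = B'"
proof -
  obtain \<phi> where \<phi>: "iso_map Z B \<phi>" "compose (pts X) \<phi> j = j'" "compose (pts Y) \<phi> i = i'"
    using assms(1) unfolding amalg_equiv_def split_conv by blast
  obtain \<psi> where \<psi>: "iso_map Z B' \<psi>" "compose (pts X) \<psi> j = j'" "compose (pts Y) \<psi> i = i'"
    using assms(2) unfolding amalg_equiv_def split_conv by blast
  have "\<phi> z = \<psi> z" if z: "z \<in> pts Z" for z
  proof -
    consider x where "x \<in> pts X" "z = j x" | y where "y \<in> pts Y" "z = i y"
      using z unfolding Z by blast
    then show ?thesis
    proof cases
      case 1
      then show ?thesis using fun_cong[OF \<phi>(2), of x] fun_cong[OF \<psi>(2), of x] by (simp add: compose_def)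
    next
      case 2
      then show ?thesis using fun_cong[OF \<phi>(3), of y] fun_cong[OF \<psi>(3), of y] by (simp add: compose_def)
    qed
  qed
  moreover have "\<phi> \<in> extensional (pts Z)" "\<psi> \<in> extensional (pts Z)"
    using \<phi>(1) \<psi>(1) by (simp_all add: iso_map_def)
  ultimately have "\<phi> = \<psi>" by (metis extensionalityI)
  then show ?thesis using iso_map_image_eq \<phi>(1) \<psi>(1) assms(4,5) by blast
qed

text \<open>Which points get identified is invariant under equivalence; this separates the two kinds
  of amalgamations below.\<close>

lemma amalg_equiv_eq_iff:
  assumes "amalg_equiv X Y (Z, j, i) (B, j', i')" "embedding X Z j" "embedding Y Z i"
    and "x \<in> pts X" "y \<in> pts Y"
  shows "j x = i y \<longleftrightarrow> j' x = i' y"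
proof -
  obtain \<phi> where \<phi>: "iso_map Z B \<phi>" "compose (pts X) \<phi> j = j'" "compose (pts Y) \<phi> i = i'"
    using assms(1) unfolding amalg_equiv_def split_conv by blast
  have "j x \<in> pts Z" "i y \<in> pts Z" using assms by (auto simp: embedding_def)
  moreover have "inj_on \<phi> (pts Z)" using \<phi>(1) by (simp add: iso_map_def bij_betw_def)
  moreover have "j' x = \<phi> (j x)" "i' y = \<phi> (i y)" using \<phi>(2,3) assms(4,5) by (auto simp: compose_def)
  ultimately show ?thesis by (auto dest: inj_onD)
qed

text \<open>Two one-point extensions of \<open>W\<close>, by \<open>x\<close> and by
  \<open>c\<close>. An amalgamation either keeps the new points apart, and then is a relation on
  \<open>P\<close> with inclusions as maps, or identifies them, and then is \<open>YY\<close>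
  itself.\<close>

locale one_point_amalgam = tree_class F
  for F :: "('a, tree_sym) rstruct set" +
  fixes W :: "'a set" and x c :: 'a and \<sigma> :: "'a \<Rightarrow> nat" and QW QX QY
  assumes new: "x \<notin> W" "c \<notin> W" "x \<noteq> c"
    and QX: "qsym (insert x W) QX" and QY: "qsym (insert c W) QY"
    and QWX: "QW = restr W QX" and QWY: "QW = restr W QY"
    and Y_in: "qstruct (insert c W) \<sigma> QY \<in> F"
begin

abbreviation "P \<equiv> insert x (insert c W)"
abbreviation "XX \<equiv> qstruct (insert x W) \<sigma> QX"
abbreviation "YY \<equiv> qstruct (insert c W) \<sigma> QY"
abbreviation "WW \<equiv> qstruct W \<sigma> QW"
abbreviation "AM \<equiv> amalgs F WW XX YY (incl W) (incl W)"
abbreviation "free_amalgam R \<equiv> (qstruct P \<sigma> R, incl (insert x W), incl (insert c W))"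
abbreviation "merged_amalgam \<equiv> (YY, (incl (insert x W))(x := c), incl (insert c W))"

definition "mergeable \<longleftrightarrow> embedding XX YY ((incl (insert x W))(x := c))"

lemma free_amalgam_in:
  assumes "qsym P R" "QX = restr (insert x W) R" "QY = restr (insert c W) R" "qstruct P \<sigma> R \<in> F"
  shows "free_amalgam R \<in> AM"
proof -
  have "embedding XX (qstruct P \<sigma> R) (incl (insert x W))"
    "embedding YY (qstruct P \<sigma> R) (incl (insert c W))"
    unfolding assms(2,3) by (rule embedding_incl[OF assms(1)]; blast)+
  then show ?thesis using assms(4) by (auto simp: amalgs_def compose_def fun_eq_iff)
qed

lemma merged_amalgam_in:
  assumes mergeable
  shows "merged_amalgam \<in> AM"
proof -
  have "embedding YY YY (incl (insert c W))"
    using QY by (simp add: embedding_qstruct inj_on_def)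
  then show ?thesis
    using assms Y_in new unfolding mergeable_def by (auto simp: amalgs_def compose_def fun_eq_iff)
qed

lemma amalgam_on_W:
  assumes "(Z, j, i) \<in> AM" "w \<in> W"
  shows "i w = j w"
proof -
  have "compose W i (incl W) w = compose W j (incl W) w" using assms(1) by (simp add: amalgs_def)
  then show ?thesis using assms(2) by (simp add: compose_def)
qed

lemma amalgam_merged:
  assumes A: "(Z, j, i) \<in> AM" and xy: "j x \<in> i ` insert c W"
  shows "mergeable \<and> amalg_equiv XX YY (Z, j, i) merged_amalgam"
proof -
  have Z: "embedding XX Z j" "embedding YY Z i" "pts Z = j ` insert x W \<union> i ` insert c W"
    using A by (auto simp: amalgs_def)
  have j: "inj_on j (insert x W)" and i: "inj_on i (insert c W)"
    and iext: "i \<in> extensional (insert c W)"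
    using Z by (auto simp: embedding_iff PiE_def)
  \<comment> \<open>\<open>x\<close> cannot be identified with a point of \<open>W\<close>, since
    both maps agree there and \<open>j\<close> is injective.\<close>
  have "j x \<noteq> i w" if "w \<in> W" for w
    using that amalgam_on_W[OF A that] j new by (auto dest: inj_onD)
  then have xc: "j x = i c" using xy by auto
  have jg: "j a = i (((incl (insert x W))(x := c)) a)" if "a \<in> insert x W" for a
    using that xc amalgam_on_W[OF A] by auto
  have "j ` insert x W \<subseteq> i ` insert c W" using xc amalgam_on_W[OF A] by force
  then have ptsZ: "pts Z = i ` insert c W" using Z(3) by blast
  \<comment> \<open>By joint surjectivity \<open>i\<close> is now an isomorphism, and its inverse
    carries the amalgamation to \<open>YY\<close>.\<close>
  then have iso: "iso_map YY Z i"
    using Z(2) i iext by (auto simp: iso_map_def embedding_iff bij_betw_def)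
  let ?\<phi> = "\<lambda>z\<in>pts Z. inv_into (insert c W) i z"
  have iso': "iso_map Z YY ?\<phi>" using iso_map_inverse[OF iso] by simp
  have \<phi>i: "?\<phi> (i y) = y" if "y \<in> insert c W" for y
    using that i ptsZ by auto
  have 1: "compose (pts YY) ?\<phi> i = incl (insert c W)"
    using \<phi>i by (auto simp: compose_def fun_eq_iff)
  have 2: "compose (pts XX) ?\<phi> j = (incl (insert x W))(x := c)"
  proof
    fix a
    show "compose (pts XX) ?\<phi> j a = ((incl (insert x W))(x := c)) a"
    proof (cases "a \<in> insert x W")
      case True
      then have "((incl (insert x W))(x := c)) a \<in> insert c W" by auto
      then show ?thesis using True jg \<phi>i by (simp only: compose_def pts_qstruct restrict_apply')
    qed (auto simp: compose_def)
  qed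
  have "embedding XX YY (compose (pts XX) ?\<phi> j)"
    by (rule embedding_compose[OF Z(1) iso_map_imp_embedding[OF iso']])
  then have mergeable unfolding mergeable_def 2 .
  moreover have "amalg_equiv XX YY (Z, j, i) merged_amalgam"
    unfolding amalg_equiv_def using iso' 1 2 by auto
  ultimately show ?thesis ..
qed

lemma amalgam_free:
  assumes A: "(Z, j, i) \<in> AM" and xy: "j x \<notin> i ` insert c W"
  shows "\<exists>R. quartic P R \<and> QX = restr (insert x W) R \<and> QY = restr (insert c W) R \<and>
    qstruct P \<sigma> R \<in> F \<and> amalg_equiv XX YY (Z, j, i) (free_amalgam R)"
proof -
  have Z: "Z \<in> F" "embedding XX Z j" "embedding YY Z i" "pts Z = j ` insert x W \<union> i ` insert c W"
    using A by (auto simp: amalgs_def)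
  obtain \<tau> R0 where R0: "Z = qstruct (pts Z) \<tau> R0" "quartic (pts Z) R0"
    using is_qstruct[OF Z(1)] by blast
  have R0': "qsym (pts Z) R0" using R0(2) by (rule qsym_quartic)
  have X: "embedding XX (qstruct (pts Z) \<tau> R0) j" using Z(2) R0(1) by simp
  have Y: "embedding YY (qstruct (pts Z) \<tau> R0) i" using Z(3) R0(1) by simp
  note X = X[unfolded embedding_qstruct[OF QX R0']] and Y = Y[unfolded embedding_qstruct[OF QY R0']]
  \<comment> \<open>\<open>j\<close> and \<open>i\<close> agree on \<open>W\<close>, so they glue to
    a bijection from \<open>P\<close> to the points of \<open>Z\<close>, along which the relation is
    pulled back.\<close>
  define \<psi> where "\<psi> = (\<lambda>a\<in>P. if a = x then j x else i a)"
  have \<psi>_j: "\<psi> a = j a" if "a \<in> insert x W" for a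
    using that amalgam_on_W[OF A] new by (auto simp: \<psi>_def)
  have \<psi>_i: "\<psi> a = i a" if "a \<in> insert c W" for a
    using that new by (auto simp: \<psi>_def)
  have "inj_on \<psi> P"
    unfolding inj_on_insert[of \<psi> x]
  proof
    show "inj_on \<psi> (insert c W)" using Y \<psi>_i inj_on_cong[of "insert c W" \<psi> i] by blast
    show "\<psi> x \<notin> \<psi> ` (insert c W - {x})" using xy \<psi>_i by (auto simp: \<psi>_def)
  qed
  moreover have "\<psi> ` P = pts Z"
  proof -
    have "\<psi> ` P = \<psi> ` insert x W \<union> \<psi> ` insert c W" by blast
    also have "\<dots> = pts Z" unfolding Z(4) using \<psi>_j \<psi>_i by (simp cong: image_cong_simp)
    finally show ?thesis .
  qed
  ultimately have bij: "bij_betw \<psi> P (pts Z)" by (simp add: bij_betw_def)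
  define R where "R = (\<lambda>a b c d. {a, b, c, d} \<subseteq> P \<and> R0 (\<psi> a) (\<psi> b) (\<psi> c) (\<psi> d))"
  have R: "quartic P R"
    unfolding R_def
    by (rule quartic_pullback[OF R0(2)]) (use bij in \<open>simp_all only: bij_betw_def order_refl\<close>)
  have colour: "\<sigma> a = \<tau> (\<psi> a)" if "a \<in> P" for a
    using that X Y \<psi>_j \<psi>_i by (cases "a = x") auto
  have "iso_map (qstruct P \<sigma> R) (qstruct (pts Z) \<tau> R0) \<psi>"
    unfolding iso_map_qstruct[OF qsym_quartic[OF R] R0']
    using bij colour by (auto simp: R_def \<psi>_def)
  then have iso: "iso_map (qstruct P \<sigma> R) Z \<psi>" using R0(1) by simp
  then have "isomorphic (qstruct P \<sigma> R) Z" unfolding isomorphic_def by blast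
  then have RF: "qstruct P \<sigma> R \<in> F"
    by (rule iso_closed[OF Z(1) is_structure_qstruct[OF qsym_quartic[OF R]]])
  have QXR: "QX = restr (insert x W) R"
  proof (intro ext)
    fix a b d e
    show "QX a b d e = restr (insert x W) R a b d e"
    proof (cases "{a, b, d, e} \<subseteq> insert x W")
      case True
      then have m: "a \<in> insert x W" "b \<in> insert x W" "d \<in> insert x W" "e \<in> insert x W"
        by simp_all
      have "QX a b d e = R0 (j a) (j b) (j d) (j e)" using X m by blast
      moreover have "{a, b, d, e} \<subseteq> P" using True by blast
      ultimately show ?thesis using True m[THEN \<psi>_j] by (simp only: restr_def R_def simp_thms)
    next
      case False
      then have "\<not> QX a b d e" using qsymD(1-4)[OF QX, of a b d e] by blast
      then show ?thesis using False by (simp only: restr_def simp_thms)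
    qed
  qed
  have QYR: "QY = restr (insert c W) R"
  proof (intro ext)
    fix a b d e
    show "QY a b d e = restr (insert c W) R a b d e"
    proof (cases "{a, b, d, e} \<subseteq> insert c W")
      case True
      then have m: "a \<in> insert c W" "b \<in> insert c W" "d \<in> insert c W" "e \<in> insert c W"
        by simp_all
      have "QY a b d e = R0 (i a) (i b) (i d) (i e)" using Y m by blast
      moreover have "{a, b, d, e} \<subseteq> P" using True by blast
      ultimately show ?thesis using True m[THEN \<psi>_i] by (simp only: restr_def R_def simp_thms)
    next
      case False
      then have "\<not> QY a b d e" using qsymD(1-4)[OF QY, of a b d e] by blast
      then show ?thesis using False by (simp only: restr_def simp_thms)
    qed
  qed
  let ?\<phi> = "\<lambda>z\<in>pts Z. inv_into P \<psi> z"
  have iso': "iso_map Z (qstruct P \<sigma> R) ?\<phi>" using iso_map_inverse[OF iso] by simp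
  have inv: "?\<phi> (\<psi> a) = a" if "a \<in> P" for a
    using that bij by (auto simp: bij_betw_inv_into_left bij_betw_def)
  have "compose (pts XX) ?\<phi> j = incl (insert x W)"
  proof
    fix a
    show "compose (pts XX) ?\<phi> j a = incl (insert x W) a"
      using inv[of a] \<psi>_j[of a] by (cases "a \<in> insert x W") (auto simp: compose_def)
  qed
  moreover have "compose (pts YY) ?\<phi> i = incl (insert c W)"
  proof
    fix a
    show "compose (pts YY) ?\<phi> i a = incl (insert c W) a"
      using inv[of a] \<psi>_i[of a] by (cases "a \<in> insert c W") (auto simp: compose_def)
  qed
  ultimately have "amalg_equiv XX YY (Z, j, i) (free_amalgam R)"
    unfolding amalg_equiv_def using iso' by auto
  then show ?thesis using R QXR QYR RF by blast
qed

text \<open>\<open>\<R>\<close> is a list of candidates. It must contain every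
  \<open>quartic\<close> relation restricting to both given ones, while its members need only be
  symmetric with these restrictions; membership in \<open>F\<close> is filtered afterwards.\<close>

lemma all_amalgs_one_point:
  assumes fin: "finite \<R>"
    and extends: "\<And>R. R \<in> \<R> \<Longrightarrow> qsym P R \<and> QX = restr (insert x W) R \<and> QY = restr (insert c W) R"
    and complete: "\<And>R. \<lbrakk>quartic P R; QX = restr (insert x W) R; QY = restr (insert c W) R\<rbrakk> \<Longrightarrow> R \<in> \<R>"
  shows "all_amalgs F WW XX YY (incl W) (incl W)
    (free_amalgam ` {R \<in> \<R>. qstruct P \<sigma> R \<in> F} \<union> (if mergeable then {merged_amalgam} else {}))"
    (is "all_amalgs _ _ _ _ _ _ ?S")
  unfolding all_amalgs_def
proof (intro conjI ballI)
  show "finite ?S" using fin by simp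
  show "?S \<subseteq> AM" using free_amalgam_in extends merged_amalgam_in by auto
  have str: "is_structure (qstruct P \<sigma> R)" if "R \<in> \<R>" for R
    using extends[OF that] by (simp add: is_structure_qstruct)
  fix A assume "A \<in> AM"
  then obtain Z j i where A: "A = (Z, j, i)" "(Z, j, i) \<in> AM" by (cases A) auto
  have emb: "embedding XX Z j" "embedding YY Z i" and ptsZ: "pts Z = j ` pts XX \<union> i ` pts YY"
    using A(2) by (auto simp: amalgs_def)
  \<comment> \<open>The two kinds of representatives are told apart by whether the image of
    \<open>x\<close> lies in the image of \<open>Y\<close>.\<close>
  have free_iff: "j x \<notin> i ` insert c W" if "amalg_equiv XX YY (Z, j, i) (free_amalgam R)" for R
  proof
    assume "j x \<in> i ` insert c W"
    then obtain y where y: "y \<in> insert c W" "j x = i y" by blast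
    then have "incl (insert x W) x = incl (insert c W) y"
      using amalg_equiv_eq_iff[OF that emb, of x y] by simp
    then show False using y(1) new by auto
  qed
  have merged_iff: "j x \<in> i ` insert c W" if "amalg_equiv XX YY (Z, j, i) merged_amalgam"
    using amalg_equiv_eq_iff[OF that emb, of x c] by simp
  show "\<exists>!B. B \<in> ?S \<and> amalg_equiv XX YY A B"
  proof (cases "j x \<in> i ` insert c W")
    case True
    from amalgam_merged[OF A(2) True] show ?thesis
      unfolding A(1) by (intro ex1I[of _ merged_amalgam]) (use free_iff True in auto)
  next
    case False
    from amalgam_free[OF A(2) False] obtain R where R: "quartic P R" "QX = restr (insert x W) R"
      "QY = restr (insert c W) R" "qstruct P \<sigma> R \<in> F" "amalg_equiv XX YY (Z, j, i) (free_amalgam R)"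
      by blast
    have RR: "R \<in> \<R>" using complete R by blast
    show ?thesis
      unfolding A(1)
    proof (rule ex1I[of _ "free_amalgam R"])
      show "free_amalgam R \<in> ?S \<and> amalg_equiv XX YY (Z, j, i) (free_amalgam R)"
        using R RR by auto
      fix B assume B: "B \<in> ?S \<and> amalg_equiv XX YY (Z, j, i) B"
      have "B \<noteq> merged_amalgam" using B merged_iff False by blast
      then obtain R' where R': "R' \<in> \<R>" "B = free_amalgam R'" using B by (auto split: if_splits)
      have "amalg_equiv XX YY (Z, j, i) (free_amalgam R')" using B R'(2) by simp
      from amalg_equiv_functional[OF this R(5) ptsZ str[OF R'(1)] str[OF RR]] show "B = free_amalgam R" using R'(2) by simp
    qed
  qed
qed

end

section \<open>Quartic relations on five points\<close>

text \<open>Three points carry no quadruple of distinct points, so both relations are empty.\<close>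

lemma qsym_restr_three:
  assumes "qsym A Q" "qsym B R" "A = {p, q, r}"
  shows "Q = restr A R"
proof (intro ext)
  fix a b c d
  have "\<not> distinct [a, b, c, d]" if "{a, b, c, d} \<subseteq> {p, q, r}"
  proof
    assume "distinct [a, b, c, d]"
    then have "4 \<le> card {p, q, r}" using card_mono[OF _ that] by simp
    moreover have "card {p, q, r} \<le> 3" by (simp add: card_insert_if)
    ultimately show False by simp
  qed
  then have no: "\<not> S a b c d" if "qsym A S" for S
    using qsymD(1-5)[OF that, of a b c d] unfolding assms(3) by blast
  show "Q a b c d = restr A R a b c d" using no[OF assms(1)] no[OF qsym_restr[OF assms(2)]] by simp
qed

lemma qsym_restr_four:
  assumes "qsym A Q" "qsym B R" "A = {p, q, r, s}"
    and "Q p q r s = R p q r s" "Q p r q s = R p r q s" "Q p s q r = R p s q r"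
  shows "Q = restr A R"
  by (rule qsym_eqI4[of p q r s]) (use assms qsym_restr[of B R A] in \<open>auto simp: restr_def\<close>)

lemma split_quartic_map:
  assumes h: "inj_on h A" "h ` A \<subseteq> B" and UV: "\<And>a. a \<in> A \<Longrightarrow> a \<in> U \<longleftrightarrow> h a \<in> V"
    and in_A: "a \<in> A" "b \<in> A" "c \<in> A" "d \<in> A"
  shows "split_quartic A {U} a b c d = split_quartic B {V} (h a) (h b) (h c) (h d)"
proof -
  have "distinct [a, b, c, d] = distinct [h a, h b, h c, h d]"
    using inj_on_eq_iff[OF h(1)] in_A by simp
  moreover have "{h a, h b, h c, h d} \<subseteq> B" using h(2) in_A by blast
  ultimately show ?thesis using in_A UV by (simp add: split_quartic_def)
qed

text \<open>Given \<open>ab|ef\<close>, transitivity in the second pair exchanges \<open>e\<close>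
  and \<open>f\<close>.\<close>

lemma quartic_swap:
  assumes R: "quartic A R" and "R a b e f" "x \<noteq> e" "x \<noteq> f"
  shows "R a b x e = R a b x f"
proof -
  have *: "R a b x v" if "R a b x u" "R a b u v" "x \<noteq> v" for u v
  proof -
    have "R x u a b" "R u v a b" using that(1,2) qsymD(7)[OF qsym_quartic[OF R]] by blast+
    then have "R x v a b" using quartic_trans[OF R] that(3) by blast
    then show ?thesis using qsymD(7)[OF qsym_quartic[OF R]] by blast
  qed
  have "R a b f e" using assms(2) qsym_sym(3)[OF qsym_quartic[OF R]] by simp
  then show ?thesis using * assms by blast
qed

lemma quartic_others:
  assumes R: "quartic A R" and "R a b c d"
  shows "\<not> R a c b d" "\<not> R a d b c"
  using quartic_exclusive[OF R] assms(2) qsym_sym(3)[OF qsym_quartic[OF R]] by metis+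

text \<open>Saturation of \<open>cd|ef\<close> offers \<open>cx|ef\<close> or \<open>cd|ex\<close>,
  and the second would give \<open>cd|xf\<close> against \<open>cx|df\<close>. From
  \<open>cx|ef\<close> the remaining quartets follow by transitivity and exchange.\<close>

lemma quartic_unique_caterpillar:
  assumes R: "quartic {x, e, c, d, f} R" and dist: "distinct [c, d, e, f, x]"
    and 1: "R c x d f" and 2: "R c d e f"
  shows "R = split_quartic {x, e, c, d, f} {{c, x}, {e, f}}"
proof -
  note sym = qsym_sym[OF qsym_quartic[OF R]]
  have ne: "distinct [x, f, e, d, c]" using dist by auto
  have "R c x e f \<or> R c d e x"
    using quartic_extend[OF R 2, of x] ne dist by simp
  moreover have "\<not> R c d e x"
  proof
    assume "R c d e x"
    then have "R c d x e" using sym by blast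
    then have "R c d x f" using quartic_swap[OF R 2, of x] ne dist by simp
    then show False using quartic_exclusive[OF R 1] by simp
  qed
  ultimately have 3: "R c x e f" by blast
  have "R d c e f" using 2 sym by blast
  then have 4: "R d x e f" using quartic_trans[OF R _ 3, of d] ne dist by simp
  have "R c x d e" using quartic_swap[OF R 3, of d] 1 ne dist by simp
  note five = this 1 2 3 4
  show ?thesis
  proof (rule qsym_eqI5[OF qsym_quartic[OF R] qsym_split_quartic, where p = c and q = x and r = d and s = e and t = f])
    fix a b u v
    assume "(a, b, u, v) \<in> {(c, x, d, e), (c, x, d, f), (c, x, e, f), (c, d, e, f), (x, d, e, f)}"
    then have "R a b u v"
      "split_quartic {x, e, c, d, f} {{c, x}, {e, f}} a b u v"
      "\<not> split_quartic {x, e, c, d, f} {{c, x}, {e, f}} a u b v"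
      "\<not> split_quartic {x, e, c, d, f} {{c, x}, {e, f}} a v b u"
      using five 4[unfolded sym(1)[of d x]] dist ne
      by (elim insertE emptyE Pair_inject; simp add: split_quartic_def)+
    then show "R a b u v = split_quartic {x, e, c, d, f} {{c, x}, {e, f}} a b u v \<and>
      R a u b v = split_quartic {x, e, c, d, f} {{c, x}, {e, f}} a u b v \<and>
      R a v b u = split_quartic {x, e, c, d, f} {{c, x}, {e, f}} a v b u"
      using quartic_others[OF R] by blast
  qed auto
qed

text \<open>The trees with five leaves that contain both \<open>cd|ef\<close> and \<open>xd|ef\<close>: the new leaf \<open>x\<close> sits on
  the branch of \<open>d\<close>, on the branch of \<open>c\<close>, on the inner edge, or at the vertex where \<open>c\<close> and \<open>d\<close>
  meet.\<close>

definition extension_splits :: "'a \<Rightarrow> 'a \<Rightarrow> 'a \<Rightarrow> 'a \<Rightarrow> 'a \<Rightarrow> 'a set set set" where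
  "extension_splits c d e f x =
     {{{d, x}, {e, f}}, {{c, x}, {e, f}}, {{c, d}, {e, f}}, {{e, f}}}"

text \<open>Transitivity gives \<open>cx|ef\<close>, which makes \<open>e\<close> and
  \<open>f\<close> interchangeable. So the tree is fixed by its quartet on \<open>c\<close>,
  \<open>d\<close>, \<open>x\<close>, \<open>f\<close>, which has three resolved forms and an
  unresolved one.\<close>

lemma quartic_extensions:
  assumes R: "quartic {x, c, d, e, f} R" and dist: "distinct [c, d, e, f, x]"
    and 1: "R c d e f" and 2: "R d x e f"
  shows "R \<in> split_quartic {x, c, d, e, f} ` extension_splits c d e f x"
proof -
  note sym = qsym_sym[OF qsym_quartic[OF R]]
  have ne: "distinct [x, f, e, d, c]" using dist by auto
  have 3: "R c x e f" using quartic_trans[OF R 1 2] ne dist by simp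
  have e_f: "R c d x e = R c d x f" "R c x d e = R c x d f" "R d x c e = R d x c f"
    by (rule quartic_swap[OF R 1] quartic_swap[OF R 3] quartic_swap[OF R 2]; use ne dist in simp)+
  \<comment> \<open>Reduces the comparison with a set of splits to the three pairings of
    \<open>c\<close>, \<open>d\<close>, \<open>x\<close>, \<open>f\<close>.\<close>
  have eqI: "R = split_quartic {x, c, d, e, f} \<U>"
    if "{e, f} \<in> \<U>" "\<U> \<subseteq> {{e, f}, {c, d}, {c, x}, {d, x}}"
      "R c d x f \<longleftrightarrow> {c, d} \<in> \<U>" "R c x d f \<longleftrightarrow> {c, x} \<in> \<U>" "R d x c f \<longleftrightarrow> {d, x} \<in> \<U>"
    for \<U>
  proof (rule qsym_eqI5[OF qsym_quartic[OF R] qsym_split_quartic, where p = c and q = d and r = x and s = e and t = f])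
    let ?S = "split_quartic {x, c, d, e, f} \<U>"
    note symS = qsym_sym[OF qsym_split_quartic[of "{x, c, d, e, f}" \<U>]]
    have bex_K: "(\<exists>U\<in>\<U>. p U) \<longleftrightarrow> (\<exists>U \<in> {{e, f}, {c, d}, {c, x}, {d, x}}. U \<in> \<U> \<and> p U)" for p
      using subset_iff[THEN iffD1, OF that(2)] by meson
    have S: "?S a b u v \<longleftrightarrow> (\<exists>U \<in> {{e, f}, {c, d}, {c, x}, {d, x}}. U \<in> \<U> \<and>
        (a \<in> U \<and> b \<in> U \<and> u \<notin> U \<and> v \<notin> U \<or> a \<notin> U \<and> b \<notin> U \<and> u \<in> U \<and> v \<in> U))"
      if "{a, b, u, v} \<subseteq> {x, c, d, e, f}" "distinct [a, b, u, v]" for a b u v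
      unfolding split_quartic_def bex_K using that by (simp only: simp_thms)
    have true: "?S c d e f" "?S c x e f" "?S d x e f"
      using dist ne that(1) by (simp_all add: S)
    have false: "\<not> ?S c e d f" "\<not> ?S c f d e" "\<not> ?S c e x f" "\<not> ?S c f x e" "\<not> ?S d e x f" "\<not> ?S d f x e"
      using dist ne by (simp_all add: S)
    have S': "?S c d x y \<longleftrightarrow> {c, d} \<in> \<U>" "?S c x d y \<longleftrightarrow> {c, x} \<in> \<U>" "?S d x c y \<longleftrightarrow> {d, x} \<in> \<U>"
      if "y \<in> {e, f}" for y
      using that dist ne by (elim insertE emptyE; simp add: S)+
    have perm: "R c e d x = R d x c e" "R c f d x = R d x c f" "?S c e d x = ?S d x c e" "?S c f d x = ?S d x c f"
      using sym symS by blast+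
    fix a b u v
    assume "(a, b, u, v) \<in> {(c, d, x, e), (c, d, x, f), (c, d, e, f), (c, x, e, f), (d, x, e, f)}"
    then consider y where "y \<in> {e, f}" "(a, b, u, v) = (c, d, x, y)"
      | "(a, b, u, v) = (c, d, e, f)" | "(a, b, u, v) = (c, x, e, f)" | "(a, b, u, v) = (d, x, e, f)"
      by blast
    then show "R a b u v = ?S a b u v \<and> R a u b v = ?S a u b v \<and> R a v b u = ?S a v b u"
    proof cases
      case 1
      then have "R c d x y \<longleftrightarrow> {c, d} \<in> \<U>" "R c x d y \<longleftrightarrow> {c, x} \<in> \<U>" "R d x c y \<longleftrightarrow> {d, x} \<in> \<U>"
        using that(3-5) e_f by auto
      then show ?thesis using 1 S'[of y] perm by auto
    next
      case 2
      then show ?thesis using true(1) false(1,2) 1 quartic_others[OF R 1] by simp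
    next
      case c3: 3
      then show ?thesis using true(2) false(3,4) 3 quartic_others[OF R 3] by simp
    next
      case 4
      then show ?thesis using true(3) false(5,6) 2 quartic_others[OF R 2] by simp
    qed
  qed auto
  have excl: "\<not> (R c d x f \<and> R c x d f)" "\<not> (R c d x f \<and> R d x c f)" "\<not> (R c x d f \<and> R d x c f)"
    using quartic_exclusive[OF R] sym by metis+
  have doubles: "{c, d} \<noteq> {e, f}" "{c, x} \<noteq> {e, f}" "{d, x} \<noteq> {e, f}"
    "{c, d} \<noteq> {c, x}" "{c, d} \<noteq> {d, x}" "{c, x} \<noteq> {d, x}"
    using dist ne by (auto simp: doubleton_eq_iff)
  consider "R c d x f" | "R c x d f" | "R d x c f" | "\<not> R c d x f" "\<not> R c x d f" "\<not> R d x c f"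
    by blast
  then show ?thesis
  proof cases
    case 1
    then have "R = split_quartic {x, c, d, e, f} {{c, d}, {e, f}}"
      using excl doubles by (intro eqI) auto
    then show ?thesis unfolding extension_splits_def by blast
  next
    case 2
    then have "R = split_quartic {x, c, d, e, f} {{c, x}, {e, f}}"
      using excl doubles by (intro eqI) auto
    then show ?thesis unfolding extension_splits_def by blast
  next
    case 3
    then have "R = split_quartic {x, c, d, e, f} {{d, x}, {e, f}}"
      using excl doubles by (intro eqI) auto
    then show ?thesis unfolding extension_splits_def by blast
  next
    case 4
    then have "R = split_quartic {x, c, d, e, f} {{e, f}}"
      using doubles by (intro eqI) auto
    then show ?thesis unfolding extension_splits_def by blast
  qed
qed

section \<open>Measures modulo an ideal\<close>

text \<open>Measures with values in the subring \<open>C\<close> of a commutative ring, modulo the ideal \<open>I\<close> of \<open>C\<close>.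
  This covers both the generators of \<^const>\<open>Theta\<close> and complex measures (\<open>I = {0}\<close>).\<close>

locale measure_mod = tree_class F
  for F :: "('a::infinite, tree_sym) rstruct set" +
  fixes \<mu> :: "('a, tree_sym) emb \<Rightarrow> 'r::comm_ring_1" and C I :: "'r set"
  assumes C_one: "1 \<in> C" and C_diff: "\<lbrakk>a \<in> C; b \<in> C\<rbrakk> \<Longrightarrow> a - b \<in> C"
    and C_mu: "E \<in> embs F \<Longrightarrow> \<mu> E \<in> C"
    and I_zero: "0 \<in> I" and I_add: "\<lbrakk>a \<in> I; b \<in> I\<rbrakk> \<Longrightarrow> a + b \<in> I"
    and I_mult: "\<lbrakk>a \<in> C; b \<in> I\<rbrakk> \<Longrightarrow> a * b \<in> I"
    and mu_iso: "\<lbrakk>(X, f, Y) \<in> embs F; iso_map X Y f\<rbrakk> \<Longrightarrow> \<mu> (X, f, Y) - 1 \<in> I"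
    and mu_comp: "\<lbrakk>(X, f, Y) \<in> embs F; (Y, g, Z) \<in> embs F\<rbrakk> \<Longrightarrow>
      \<mu> (X, compose (pts X) g f, Z) - \<mu> (Y, g, Z) * \<mu> (X, f, Y) \<in> I"
    and mu_amalg: "\<lbrakk>(W, i, X) \<in> embs F; (W, j, Y) \<in> embs F; all_amalgs F W X Y i j S\<rbrakk> \<Longrightarrow>
      \<mu> (W, i, X) - (\<Sum>(Z, j', i') \<in> S. \<mu> (Y, i', Z)) \<in> I"
begin

section \<open>Congruence modulo the ideal and invariance under isomorphism\<close>

definition eqv :: "'r \<Rightarrow> 'r \<Rightarrow> bool" (infix "\<asymp>" 50) where
  "a \<asymp> b \<longleftrightarrow> a - b \<in> I"

lemma I_minus: "a \<in> I \<Longrightarrow> - a \<in> I"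
  \<comment> \<open>The multiplier is \<open>1 - 1 - 1\<close>, that is -1, in \<open>C\<close> by
    closure under differences.\<close>
  using I_mult[OF C_diff[OF C_diff[OF C_one C_one] C_one], of a] by simp

lemma I_diff: "\<lbrakk>a \<in> I; b \<in> I\<rbrakk> \<Longrightarrow> a - b \<in> I"
  using I_add[of a "- b"] I_minus by simp

lemma eqv_refl [simp]: "a \<asymp> a"
  by (simp add: eqv_def I_zero)

lemma eqv_sym: "a \<asymp> b \<Longrightarrow> b \<asymp> a"
  using I_minus[of "a - b"] by (simp add: eqv_def)

lemma eqv_trans [trans]: "\<lbrakk>a \<asymp> b; b \<asymp> c\<rbrakk> \<Longrightarrow> a \<asymp> c"
  using I_add[of "a - b" "b - c"] by (simp add: eqv_def)

lemma eqv_add: "\<lbrakk>a \<asymp> b; c \<asymp> d\<rbrakk> \<Longrightarrow> a + c \<asymp> b + d"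
  using I_add[of "a - b" "c - d"] by (simp add: eqv_def algebra_simps)

lemma eqv_diff: "\<lbrakk>a \<asymp> b; c \<asymp> d\<rbrakk> \<Longrightarrow> a - c \<asymp> b - d"
  using I_diff[of "a - b" "c - d"] by (simp add: eqv_def algebra_simps)

text \<open>\<open>a * c - b * d = c * (a - b) + b * (c - d)\<close>. Only elements of
  \<open>C\<close> may multiply \<open>I\<close>, whence the conditions on \<open>b\<close> and
  \<open>c\<close>.\<close>

lemma eqv_mult:
  assumes "a \<asymp> b" "c \<asymp> d" "b \<in> C" "c \<in> C"
  shows "a * c \<asymp> b * d"
proof -
  have "c * (a - b) + b * (c - d) \<in> I" using assms I_add I_mult by (simp add: eqv_def)
  then show ?thesis by (simp add: eqv_def algebra_simps)
qed

text \<open>Both composites in the commuting square are the same embedding, and the isomorphisms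
  contribute factors congruent to 1.\<close>

lemma mu_iso_invariant:
  assumes E: "(W, i, X) \<in> embs F" "(W', i', X') \<in> embs F"
    and g: "iso_map W W' g" and h: "iso_map X X' h" and comm: "compose (pts W) h i = compose (pts W) i' g"
  shows "\<mu> (W, i, X) \<asymp> \<mu> (W', i', X')"
proof -
  have gh: "(W, g, W') \<in> embs F" "(X, h, X') \<in> embs F"
    using E iso_map_imp_embedding[OF g] iso_map_imp_embedding[OF h] by (auto simp: embs_def)
  have 1: "\<mu> (X, h, X') * \<mu> (W, i, X) \<asymp> 1 * \<mu> (W, i, X)"
    using mu_iso[OF gh(2) h] C_mu E(1) C_one by (intro eqv_mult) (simp_all add: eqv_def I_zero)
  have 2: "\<mu> (W', i', X') * \<mu> (W, g, W') \<asymp> \<mu> (W', i', X') * 1"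
    using mu_iso[OF gh(1) g] C_mu E(2) gh(1) by (intro eqv_mult) (simp_all add: eqv_def I_zero)
  have 3: "\<mu> (W, compose (pts W) h i, X') \<asymp> \<mu> (X, h, X') * \<mu> (W, i, X)"
    using mu_comp[OF E(1) gh(2)] by (simp add: eqv_def)
  have 4: "\<mu> (W, compose (pts W) h i, X') \<asymp> \<mu> (W', i', X') * \<mu> (W, g, W')"
    using mu_comp[OF gh(1) E(2)] by (simp add: eqv_def comm)
  show ?thesis
    using eqv_trans[OF eqv_sym[OF eqv_trans[OF 3 1]] eqv_trans[OF 4 2]] by simp
qed

lemma embs_incl:
  assumes "qsym B R" "A \<subseteq> B" "qstruct A \<sigma> (restr A R) \<in> F" "qstruct B \<sigma> R \<in> F"
  shows "(qstruct A \<sigma> (restr A R), incl A, qstruct B \<sigma> R) \<in> embs F"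
  using assms embedding_incl[OF assms(1,2)] by (simp add: embs_def)

lemma restr_restr: "A \<subseteq> B \<Longrightarrow> restr A (restr B R) = restr A R"
  by (auto simp: restr_def fun_eq_iff)

text \<open>The inclusion of \<open>A\<close> into \<open>P\<close> factors through \<open>B\<close>
  and through \<open>B'\<close>; multiplicativity evaluates it both ways.\<close>

lemma mu_exchange:
  assumes R: "qsym P R" and sub: "A \<subseteq> B" "B \<subseteq> P" "A \<subseteq> B'" "B' \<subseteq> P"
    and in_F: "qstruct A \<sigma> (restr A R) \<in> F" "qstruct B \<sigma> (restr B R) \<in> F"
      "qstruct B' \<sigma> (restr B' R) \<in> F" "qstruct P \<sigma> R \<in> F"
  shows "\<mu> (qstruct B \<sigma> (restr B R), incl B, qstruct P \<sigma> R)
      * \<mu> (qstruct A \<sigma> (restr A R), incl A, qstruct B \<sigma> (restr B R))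
    \<asymp> \<mu> (qstruct B' \<sigma> (restr B' R), incl B', qstruct P \<sigma> R)
      * \<mu> (qstruct A \<sigma> (restr A R), incl A, qstruct B' \<sigma> (restr B' R))"
proof -
  have "\<mu> (qstruct A \<sigma> (restr A R), incl A, qstruct P \<sigma> R) \<asymp>
    \<mu> (qstruct D \<sigma> (restr D R), incl D, qstruct P \<sigma> R)
      * \<mu> (qstruct A \<sigma> (restr A R), incl A, qstruct D \<sigma> (restr D R))"
    if D: "A \<subseteq> D" "D \<subseteq> P" "qstruct D \<sigma> (restr D R) \<in> F" for D
  proof -
    have 1: "(qstruct D \<sigma> (restr D R), incl D, qstruct P \<sigma> R) \<in> embs F"
      by (rule embs_incl[OF R D(2,3) in_F(4)])
    have 2: "(qstruct A \<sigma> (restr A R), incl A, qstruct D \<sigma> (restr D R)) \<in> embs F"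
      using embs_incl[OF qsym_restr[OF R] D(1), of \<sigma>] restr_restr[OF D(1), of R] in_F(1) D(3) by simp
    have "compose A (incl D) (incl A) = incl A"
      using D(1) by (auto simp: compose_def fun_eq_iff)
    then show ?thesis using mu_comp[OF 2 1] by (simp add: eqv_def)
  qed
  from this[OF sub(1,2) in_F(2)] this[OF sub(3,4) in_F(3)] show ?thesis
    using eqv_sym eqv_trans by blast
qed

end

section \<open>The amalgamation rule for one-point extensions\<close>

locale measured_amalgam = measure_mod F \<mu> C I + one_point_amalgam F W x c \<sigma> QW QX QY
  for F :: "('a::infinite, tree_sym) rstruct set" and \<mu> :: "('a, tree_sym) emb \<Rightarrow> 'r::comm_ring_1"
    and C I W x c \<sigma> QW QX QY +
  assumes W_in: "WW \<in> F" and X_in: "XX \<in> F"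
begin

lemma mu_one_point:
  assumes fin: "finite \<R>"
    and extends: "\<And>R. R \<in> \<R> \<Longrightarrow> qsym P R \<and> QX = restr (insert x W) R \<and> QY = restr (insert c W) R"
    and complete: "\<And>R. \<lbrakk>quartic P R; QX = restr (insert x W) R; QY = restr (insert c W) R\<rbrakk> \<Longrightarrow> R \<in> \<R>"
  shows "\<mu> (WW, incl W, XX) \<asymp>
    (\<Sum>R \<in> {R \<in> \<R>. qstruct P \<sigma> R \<in> F}. \<mu> (YY, incl (insert c W), qstruct P \<sigma> R)) +
    (if mergeable then 1 else 0)"
proof -
  let ?S1 = "free_amalgam ` {R \<in> \<R>. qstruct P \<sigma> R \<in> F}"
  let ?S2 = "if mergeable then {merged_amalgam} else {}"
  let ?g = "\<lambda>(Z, j', i'). \<mu> (YY, i', Z)"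
  have emb: "(WW, incl W, XX) \<in> embs F" "(WW, incl W, YY) \<in> embs F"
    using embedding_incl[OF QX, of W \<sigma>] embedding_incl[OF QY, of W \<sigma>] W_in X_in Y_in
    by (auto simp: embs_def QWX[symmetric] QWY[symmetric])
  have YY: "iso_map YY YY (incl (insert c W))"
    using QY by (simp add: iso_map_qstruct bij_betw_def inj_on_def)
  then have "(YY, incl (insert c W), YY) \<in> embs F"
    using iso_map_imp_embedding Y_in by (auto simp: embs_def)
  \<comment> \<open>The merged amalgamation contributes the class of the identity of
    \<open>YY\<close>.\<close>
  from mu_iso[OF this YY] have S2: "(\<Sum>A\<in>?S2. ?g A) \<asymp> (if mergeable then 1 else 0)"
    by (simp add: eqv_def I_zero)
  \<comment> \<open>Distinct relations give distinct structures, so the sum may run over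
    relations.\<close>
  have S1: "(\<Sum>A\<in>?S1. ?g A) =
    (\<Sum>R \<in> {R \<in> \<R>. qstruct P \<sigma> R \<in> F}. \<mu> (YY, incl (insert c W), qstruct P \<sigma> R))"
    by (subst sum.reindex) (auto intro!: inj_onI dest: qstruct_inject)
  have "?S1 \<inter> ?S2 = {}"
  proof -
    have "incl (insert x W) \<noteq> (incl (insert x W))(x := c)"
      using new(3) by (metis fun_upd_same insertI1 restrict_apply')
    then show ?thesis by auto
  qed
  then have S12: "(\<Sum>A\<in>?S1 \<union> ?S2. ?g A) = (\<Sum>A\<in>?S1. ?g A) + (\<Sum>A\<in>?S2. ?g A)"
    using fin by (intro sum.union_disjoint) auto
  have "\<mu> (WW, incl W, XX) \<asymp> (\<Sum>A\<in>?S1 \<union> ?S2. ?g A)"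
    using mu_amalg[OF emb all_amalgs_one_point[OF assms]] by (simp only: eqv_def)
  from eqv_trans[OF this[unfolded S12 S1] eqv_add[OF eqv_refl S2]] show ?thesis .
qed

end

section \<open>Classes of leaf insertions and the relations between them\<close>

context measure_mod
begin

abbreviation (input) "colours \<sigma> \<equiv> \<forall>a::'a. \<sigma> a \<in> {1, 2::nat}"

text \<open>Inserts \<open>x\<close> on the branch of \<open>c\<close> in the star on
  \<open>c\<close>, \<open>d\<close>, \<open>f\<close>, which produces the quartet
  \<open>cx|df\<close>.\<close>

definition branch :: "('a \<Rightarrow> nat) \<Rightarrow> 'a \<Rightarrow> 'a \<Rightarrow> 'a \<Rightarrow> 'a \<Rightarrow> 'r" where
  "branch \<sigma> c d f x =
     \<mu> (split_struct {c, d, f} \<sigma> {}, incl {c, d, f}, split_struct {x, c, d, f} \<sigma> {{c, x}})"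

text \<open>The same insertion on the branch of \<open>c\<close>, now in the quartet
  \<open>cd|ef\<close>.\<close>

definition branch4 :: "('a \<Rightarrow> nat) \<Rightarrow> 'a \<Rightarrow> 'a \<Rightarrow> 'a \<Rightarrow> 'a \<Rightarrow> 'a \<Rightarrow> 'r" where
  "branch4 \<sigma> c d e f x =
     \<mu> (split_struct {c, d, e, f} \<sigma> {{c, d}}, incl {c, d, e, f},
        split_struct {x, c, d, e, f} \<sigma> {{c, x}, {e, f}})"

text \<open>Inserts \<open>x\<close> on the inner edge of \<open>cd|ef\<close>, as the middle leaf
  of a caterpillar.\<close>

definition inner4 :: "('a \<Rightarrow> nat) \<Rightarrow> 'a \<Rightarrow> 'a \<Rightarrow> 'a \<Rightarrow> 'a \<Rightarrow> 'a \<Rightarrow> 'r" where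
  "inner4 \<sigma> c d e f x =
     \<mu> (split_struct {c, d, e, f} \<sigma> {{c, d}}, incl {c, d, e, f},
        split_struct {x, c, d, e, f} \<sigma> {{c, d}, {e, f}})"

lemma struct3_in: "\<lbrakk>colours \<sigma>; distinct [a, b, c]\<rbrakk> \<Longrightarrow> split_struct {a, b, c} \<sigma> {} \<in> F"
  by (rule star3_in) auto

lemma struct4_in:
  assumes "colours \<sigma>" "distinct [a, b, c, d]" "A = {a, b, c, d}"
  shows "split_struct A \<sigma> {{a, b}} \<in> F"
  unfolding assms(3) by (rule quartet4_in) (use assms in auto)

lemma struct5_in:
  assumes "colours \<sigma>" "distinct [a, b, m, c, d]" "A = {a, b, m, c, d}"
  shows "split_struct A \<sigma> {{a, b}, {c, d}} \<in> F"
  unfolding assms(3) by (rule caterpillar5_in) (use assms in auto)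

lemma branch_commute: "branch \<sigma> c d f x = branch \<sigma> c f d x"
  by (simp add: branch_def insert_commute)

lemma branch4_commute: "branch4 \<sigma> c d e f x = branch4 \<sigma> c d f e x"
  by (simp add: branch4_def insert_commute)

text \<open>A split may be named by either side; this makes the inner edge symmetric in
  \<open>c\<close>, \<open>d\<close> and \<open>e\<close>, \<open>f\<close>.\<close>

lemma split_quartic_compl:
  assumes "{c, d, e, f} = A" "distinct [c, d, e, f]"
  shows "split_quartic A {{c, d}} = split_quartic A {{e, f}}"
proof -
  have "distinct [f, e, d, c]" using assms(2) by auto
  then show ?thesis
    unfolding assms(1)[symmetric]
    by (intro qsym_eqI4[OF qsym_split_quartic qsym_split_quartic]; use assms(2) in \<open>simp add: split_quartic_def\<close>)
qed

lemma inner4_commute: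
  assumes "distinct [c, d, e, f]"
  shows "inner4 \<sigma> c d e f x = inner4 \<sigma> e f c d x"
proof -
  have A: "{c, d, e, f} = {e, f, c, d}" by auto
  have "split_struct {c, d, e, f} \<sigma> {{c, d}} = split_struct {e, f, c, d} \<sigma> {{e, f}}"
    unfolding split_struct_def A using split_quartic_compl[OF A assms] by simp
  moreover have "{x, c, d, e, f} = {x, e, f, c, d}" "{{c, d}, {e, f}} = {{e, f}, {c, d}}" by auto
  ultimately show ?thesis unfolding inner4_def A by (simp only:)
qed

lemma split_quartic_three: "qsym B R \<Longrightarrow> split_quartic {c, d, f} \<U> = restr {c, d, f} R"
  by (rule qsym_restr_three[OF qsym_split_quartic _ refl])

lemma branch_emb:
  assumes "colours \<sigma>" "distinct [c, d, f, x]"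
  shows "(split_struct {c, d, f} \<sigma> {}, incl {c, d, f}, split_struct {x, c, d, f} \<sigma> {{c, x}}) \<in> embs F"
proof -
  let ?R = "split_quartic {x, c, d, f} {{c, x}}"
  have X: "split_struct {x, c, d, f} \<sigma> {{c, x}} \<in> F"
    by (rule struct4_in[of _ c x d f]) (use assms in auto)
  have W: "split_struct {c, d, f} \<sigma> {} \<in> F"
    by (rule struct3_in) (use assms in auto)
  have three: "split_quartic {c, d, f} {} = restr {c, d, f} ?R"
    by (rule split_quartic_three[OF qsym_split_quartic])
  show ?thesis
    unfolding split_struct_def three
    by (rule embs_incl[OF qsym_split_quartic]) (use X W in \<open>auto simp: split_struct_def three\<close>)
qed

text \<open>The relabelling \<open>h\<close> respects the trees, and it respects the colours by
  assumption, so isomorphism invariance applies.\<close>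

lemma branch_cong:
  assumes \<sigma>: "colours \<sigma>" "colours \<tau>" and dist: "distinct [c, d, f, x]" "distinct [c', d', f', x']"
    and eq: "\<sigma> c = \<tau> c'" "\<sigma> d = \<tau> d'" "\<sigma> f = \<tau> f'" "\<sigma> x = \<tau> x'"
  shows "branch \<sigma> c d f x \<asymp> branch \<tau> c' d' f' x'"
proof -
  define h where "h = (\<lambda>_. undefined)(c := c', d := d', f := f', x := x')"
  have ne: "distinct [x, f, d, c]" "distinct [x', f', d', c']" using dist by auto
  have h: "h c = c'" "h d = d'" "h f = f'" "h x = x'"
    using dist ne by (simp_all add: h_def)
  have bij: "bij_betw h {x, c, d, f} {x', c', d', f'}"
    using h dist ne by (auto simp: bij_betw_def inj_on_def)
  show ?thesis
    unfolding branch_def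
  proof (rule mu_iso_invariant[OF branch_emb[OF \<sigma>(1) dist(1)] branch_emb[OF \<sigma>(2) dist(2)]])
    show "iso_map (split_struct {c, d, f} \<sigma> {}) (split_struct {c', d', f'} \<tau> {}) (restrict h {c, d, f})"
      unfolding split_struct_def iso_map_qstruct[OF qsym_split_quartic qsym_split_quartic]
      using h dist ne eq by (auto simp: bij_betw_def inj_on_def split_quartic_def)
    show "iso_map (split_struct {x, c, d, f} \<sigma> {{c, x}}) (split_struct {x', c', d', f'} \<tau> {{c', x'}})
        (restrict h {x, c, d, f})"
      unfolding split_struct_def iso_map_qstruct[OF qsym_split_quartic qsym_split_quartic]
    proof (intro conjI ballI)
      show "bij_betw (restrict h {x, c, d, f}) {x, c, d, f} {x', c', d', f'}"
        using bij by (subst bij_betw_restrict_eq)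
      show "\<sigma> a = \<tau> (restrict h {x, c, d, f} a)" if "a \<in> {x, c, d, f}" for a
        using that h eq by auto
      fix a b u v
      assume in4: "a \<in> {x, c, d, f}" "b \<in> {x, c, d, f}" "u \<in> {x, c, d, f}" "v \<in> {x, c, d, f}"
      have "split_quartic {x, c, d, f} {{c, x}} a b u v =
        split_quartic {x', c', d', f'} {{c', x'}} (h a) (h b) (h u) (h v)"
      proof (rule split_quartic_map[OF _ _ _ in4])
        show "inj_on h {x, c, d, f}" "h ` {x, c, d, f} \<subseteq> {x', c', d', f'}"
          using bij by (simp_all only: bij_betw_def order_refl)
        show "a \<in> {c, x} \<longleftrightarrow> h a \<in> {c', x'}" if "a \<in> {x, c, d, f}" for a
          using that dist ne by (elim insertE emptyE; simp add: h)
      qed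
      then show "split_quartic {x, c, d, f} {{c, x}} a b u v =
        split_quartic {x', c', d', f'} {{c', x'}} (restrict h {x, c, d, f} a) (restrict h {x, c, d, f} b)
          (restrict h {x, c, d, f} u) (restrict h {x, c, d, f} v)"
        using in4 by (simp only: restrict_apply')
    qed simp
    show "compose (pts (split_struct {c, d, f} \<sigma> {})) (restrict h {x, c, d, f}) (incl {c, d, f}) =
      compose (pts (split_struct {c, d, f} \<sigma> {})) (incl {c', d', f'}) (restrict h {c, d, f})"
      using h by (auto simp: split_struct_def compose_def fun_eq_iff)
  qed
qed

text \<open>Amalgamating \<open>cx|df\<close> with \<open>cd|ef\<close> over \<open>c\<close>,
  \<open>d\<close>, \<open>f\<close> has a single outcome. Since the right side is symmetric in
  \<open>e\<close> and \<open>f\<close>, this later allows \<open>f\<close> to be replaced by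
  \<open>e\<close>.\<close>

lemma branch_eqv_branch4:
  assumes \<sigma>: "colours \<sigma>" and dist: "distinct [c, d, e, f, x]"
  shows "branch \<sigma> c d f x \<asymp> branch4 \<sigma> c d e f x"
proof -
  let ?P = "{x, e, c, d, f}"
  let ?R = "split_quartic ?P {{c, x}, {e, f}}"
  let ?QX = "split_quartic {x, c, d, f} {{c, x}}" and ?QY = "split_quartic {e, c, d, f} {{c, d}}"
  have ne: "distinct [x, f, e, d, c]" using dist by auto
  interpret A: measured_amalgam F \<mu> C I "{c, d, f}" x e \<sigma> "split_quartic {c, d, f} {}" ?QX ?QY
  proof unfold_locales
    show "x \<notin> {c, d, f}" "e \<notin> {c, d, f}" "x \<noteq> e" using dist ne by auto
    show "qsym {x, c, d, f} ?QX" "qsym {e, c, d, f} ?QY" by (rule qsym_split_quartic)+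
    show "split_quartic {c, d, f} {} = restr {c, d, f} ?QX"
      "split_quartic {c, d, f} {} = restr {c, d, f} ?QY"
      by (rule split_quartic_three, rule qsym_split_quartic)+
    show "qstruct {e, c, d, f} \<sigma> ?QY \<in> F"
      by (fold split_struct_def, rule struct4_in[of _ c d e f]) (use \<sigma> dist in auto)
    show "qstruct {x, c, d, f} \<sigma> ?QX \<in> F"
      by (fold split_struct_def, rule struct4_in[of _ c x d f]) (use \<sigma> dist in auto)
    show "qstruct {c, d, f} \<sigma> (split_quartic {c, d, f} {}) \<in> F"
      by (fold split_struct_def, rule struct3_in) (use \<sigma> dist in auto)
  qed
  have R_in: "qstruct ?P \<sigma> ?R \<in> F"
    by (fold split_struct_def, rule struct5_in[of _ c x d e f]) (use \<sigma> dist in auto)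
  \<comment> \<open>Identifying \<open>x\<close> with \<open>e\<close> would turn
    \<open>cx|df\<close> into \<open>ce|df\<close>, whereas the other structure has
    \<open>cd|ef\<close>.\<close>
  have not_mergeable: "\<not> A.mergeable"
  proof
    assume A.mergeable
    then have "\<forall>a\<in>{x, c, d, f}. \<forall>b\<in>{x, c, d, f}. \<forall>u\<in>{x, c, d, f}. \<forall>v\<in>{x, c, d, f}.
      ?QX a b u v = ?QY (((incl {x, c, d, f})(x := e)) a) (((incl {x, c, d, f})(x := e)) b)
        (((incl {x, c, d, f})(x := e)) u) (((incl {x, c, d, f})(x := e)) v)"
      unfolding A.mergeable_def embedding_qstruct[OF qsym_split_quartic qsym_split_quartic] by blast
    then have "?QX x c d f = ?QY e c d f"
      using dist ne by simp
    then show False using dist ne by (simp add: split_quartic_def)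
  qed
  have "\<mu> (A.WW, incl {c, d, f}, A.XX) \<asymp>
    (\<Sum>R \<in> {R \<in> {?R}. qstruct ?P \<sigma> R \<in> F}. \<mu> (A.YY, incl {e, c, d, f}, qstruct ?P \<sigma> R)) +
    (if A.mergeable then 1 else 0)"
  proof (rule A.mu_one_point)
    fix R assume R: "R \<in> {?R}"
    show "qsym ?P R \<and> ?QX = restr {x, c, d, f} R \<and> ?QY = restr {e, c, d, f} R"
    proof (intro conjI)
      show "qsym ?P R" using R qsym_split_quartic by blast
      then show "?QX = restr {x, c, d, f} R"
        by (rule qsym_restr_four[OF qsym_split_quartic _ refl]; use R dist ne in \<open>simp add: split_quartic_def\<close>)
      show "?QY = restr {e, c, d, f} R"
        by (rule qsym_restr_four[OF qsym_split_quartic \<open>qsym ?P R\<close> refl]; use R dist ne in \<open>simp add: split_quartic_def\<close>)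
    qed
  next
    fix R assume R: "quartic ?P R" "?QX = restr {x, c, d, f} R" "?QY = restr {e, c, d, f} R"
    have "?QX c x d f" "?QY c d e f" using dist ne by (simp_all add: split_quartic_def)
    then have "R c x d f" "R c d e f" using R(2,3) by (simp_all add: restr_def)
    from quartic_unique_caterpillar[OF R(1) dist this] show "R \<in> {?R}" by simp
  qed simp
  from this[unfolded if_not_P[OF not_mergeable]]
  have main: "\<mu> (A.WW, incl {c, d, f}, A.XX) \<asymp> \<mu> (A.YY, incl {e, c, d, f}, qstruct ?P \<sigma> ?R)"
    using R_in by (simp cong: conj_cong)
  have "{e, c, d, f} = {c, d, e, f}" "{x, e, c, d, f} = {x, c, d, e, f}" by auto
  then show ?thesis
    using main unfolding branch_def branch4_def split_struct_def by (simp only:)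
qed

text \<open>The contribution of the amalgamations that keep \<open>x\<close> and \<open>c\<close>
  apart. The filter accommodates the tree with a vertex of degree 4, whose membership depends on the
  class; the value is never computed but eliminated by symmetry in \<open>c\<close> and
  \<open>d\<close>.\<close>

definition extension_sum :: "('a \<Rightarrow> nat) \<Rightarrow> 'a \<Rightarrow> 'a \<Rightarrow> 'a \<Rightarrow> 'a \<Rightarrow> 'a \<Rightarrow> 'r" where
  "extension_sum \<sigma> c d e f x =
    (\<Sum>R \<in> {R \<in> split_quartic {x, c, d, e, f} ` extension_splits c d e f x. qstruct {x, c, d, e, f} \<sigma> R \<in> F}.
       \<mu> (split_struct {c, d, e, f} \<sigma> {{c, d}}, incl {c, d, e, f}, qstruct {x, c, d, e, f} \<sigma> R))"

lemma extension_sum_commute: "extension_sum \<sigma> c d e f x = extension_sum \<sigma> d c e f x"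
proof -
  have "extension_splits c d e f x = extension_splits d c e f x"
    unfolding extension_splits_def by (auto simp: insert_commute)
  moreover have "{x, c, d, e, f} = {x, d, c, e, f}" "{c, d, e, f} = {d, c, e, f}" "{c, d} = {d, c}" by auto
  ultimately show ?thesis unfolding extension_sum_def by (simp only:)
qed

text \<open>Amalgamate \<open>dx|ef\<close> with \<open>cd|ef\<close> over \<open>d\<close>,
  \<open>e\<close>, \<open>f\<close>. The two quartets have the same shape, so merging
  \<open>x\<close> with \<open>c\<close> is possible exactly when their colours agree.\<close>

lemma branch_eqv_extension_sum:
  assumes \<sigma>: "colours \<sigma>" and dist: "distinct [c, d, e, f, x]"
  shows "branch \<sigma> d e f x \<asymp> extension_sum \<sigma> c d e f x + (if \<sigma> x = \<sigma> c then 1 else 0)"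
proof -
  let ?P = "{x, c, d, e, f}"
  let ?QX = "split_quartic {x, d, e, f} {{d, x}}" and ?QY = "split_quartic {c, d, e, f} {{c, d}}"
  have ne: "distinct [x, f, e, d, c]" using dist by auto
  interpret A: measured_amalgam F \<mu> C I "{d, e, f}" x c \<sigma> "split_quartic {d, e, f} {}" ?QX ?QY
  proof unfold_locales
    show "x \<notin> {d, e, f}" "c \<notin> {d, e, f}" "x \<noteq> c" using dist ne by auto
    show "qsym {x, d, e, f} ?QX" "qsym {c, d, e, f} ?QY" by (rule qsym_split_quartic)+
    show "split_quartic {d, e, f} {} = restr {d, e, f} ?QX"
      "split_quartic {d, e, f} {} = restr {d, e, f} ?QY"
      by (rule split_quartic_three, rule qsym_split_quartic)+
    show "qstruct {c, d, e, f} \<sigma> ?QY \<in> F"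
      by (fold split_struct_def, rule struct4_in[of _ c d e f]) (use \<sigma> dist in auto)
    show "qstruct {x, d, e, f} \<sigma> ?QX \<in> F"
      by (fold split_struct_def, rule struct4_in[of _ d x e f]) (use \<sigma> dist in auto)
    show "qstruct {d, e, f} \<sigma> (split_quartic {d, e, f} {}) \<in> F"
      by (fold split_struct_def, rule struct3_in) (use \<sigma> dist in auto)
  qed
  let ?h = "(incl {x, d, e, f})(x := c)"
  have h: "?h x = c" "?h d = d" "?h e = e" "?h f = f" using dist by auto
  have mergeable: "A.mergeable \<longleftrightarrow> \<sigma> x = \<sigma> c"
  proof
    assume A.mergeable
    then have "\<sigma> x = \<sigma> (?h x)"
      unfolding A.mergeable_def embedding_qstruct[OF qsym_split_quartic qsym_split_quartic] by blast
    then show "\<sigma> x = \<sigma> c" by simp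
  next
    assume x: "\<sigma> x = \<sigma> c"
    have inj: "inj_on ?h {x, d, e, f}" using dist ne by (auto simp: inj_on_def)
    have img: "?h ` {x, d, e, f} \<subseteq> {c, d, e, f}" using h by auto
    show A.mergeable
      unfolding A.mergeable_def embedding_qstruct[OF qsym_split_quartic qsym_split_quartic]
    proof (intro conjI ballI inj)
      show "?h \<in> {x, d, e, f} \<rightarrow>\<^sub>E {c, d, e, f}"
        using img by (intro PiE_I) auto
      show "\<sigma> a = \<sigma> (?h a)" if "a \<in> {x, d, e, f}" for a
        using that x by auto
      fix a b u v
      assume in4: "a \<in> {x, d, e, f}" "b \<in> {x, d, e, f}" "u \<in> {x, d, e, f}" "v \<in> {x, d, e, f}"
      show "?QX a b u v = ?QY (?h a) (?h b) (?h u) (?h v)"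
      proof (rule split_quartic_map[OF inj img _ in4])
        show "a \<in> {d, x} \<longleftrightarrow> ?h a \<in> {c, d}" if "a \<in> {x, d, e, f}" for a
          using that dist ne by (elim insertE emptyE; simp)
      qed
    qed
  qed
  have "\<mu> (A.WW, incl {d, e, f}, A.XX) \<asymp>
    (\<Sum>R \<in> {R \<in> split_quartic ?P ` extension_splits c d e f x. qstruct ?P \<sigma> R \<in> F}.
      \<mu> (A.YY, incl {c, d, e, f}, qstruct ?P \<sigma> R)) +
    (if A.mergeable then 1 else 0)"
  proof (rule A.mu_one_point)
    fix R assume R: "R \<in> split_quartic ?P ` extension_splits c d e f x"
    have qR: "qsym ?P R" using R qsym_split_quartic by blast
    have "?QX = restr {x, d, e, f} R"
      by (rule qsym_restr_four[OF qsym_split_quartic qR refl];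
          use R dist ne in \<open>auto simp: extension_splits_def split_quartic_def\<close>)
    moreover have "?QY = restr {c, d, e, f} R"
      by (rule qsym_restr_four[OF qsym_split_quartic qR refl];
          use R dist ne in \<open>auto simp: extension_splits_def split_quartic_def\<close>)
    ultimately show "qsym ?P R \<and> ?QX = restr {x, d, e, f} R \<and> ?QY = restr {c, d, e, f} R"
      using qR by blast
  next
    fix R assume R: "quartic ?P R" "?QX = restr {x, d, e, f} R" "?QY = restr {c, d, e, f} R"
    have "?QX d x e f" "?QY c d e f" using dist ne by (simp_all add: split_quartic_def)
    then have "R d x e f" "R c d e f" using R(2,3) by (simp_all add: restr_def)
    then show "R \<in> split_quartic ?P ` extension_splits c d e f x"
      using quartic_extensions[OF R(1) dist] by blast
  qed (simp add: extension_splits_def)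
  then show ?thesis
    unfolding branch_def extension_sum_def split_struct_def mergeable .
qed

text \<open>The five-leaf tree is built from the star on \<open>d\<close>, \<open>e\<close>,
  \<open>f\<close> by adding \<open>c\<close> first or \<open>x\<close> first. Beside the cherry
  \<open>ef\<close> it has the cherry \<open>cx\<close> in the first claim, and the cherry
  \<open>cd\<close> with \<open>x\<close> in the middle in the second.\<close>

lemma
  assumes \<sigma>: "colours \<sigma>" and dist: "distinct [c, d, e, f, x]"
  shows branch_cherry:
      "branch4 \<sigma> c d e f x * branch \<sigma> d e f c \<asymp> branch4 \<sigma> x d e f c * branch \<sigma> d e f x"
    and branch_inner:
      "inner4 \<sigma> c d e f x * branch \<sigma> d e f c \<asymp> branch4 \<sigma> d x e f c * branch \<sigma> d e f x"
proof -
  let ?P = "{x, c, d, e, f}"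
  have ne: "distinct [x, f, e, d, c]" using dist by auto
  have sets: "{c, x, d, e, f} = ?P" "{c, d, x, e, f} = ?P" "{d, x, e, f} = {x, d, e, f}"
    "{d, c} = {c, d}" "{x, c} = {c, x}" "{x, d} = {d, x}" by auto
  have exch: "\<mu> (split_struct {c, d, e, f} \<sigma> {{c, d}}, incl {c, d, e, f}, split_struct ?P \<sigma> \<U>)
      * \<mu> (split_struct {d, e, f} \<sigma> {}, incl {d, e, f}, split_struct {c, d, e, f} \<sigma> {{c, d}})
    \<asymp> \<mu> (split_struct {x, d, e, f} \<sigma> {{d, x}}, incl {x, d, e, f}, split_struct ?P \<sigma> \<U>)
      * \<mu> (split_struct {d, e, f} \<sigma> {}, incl {d, e, f}, split_struct {x, d, e, f} \<sigma> {{d, x}})"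
    if \<U>: "\<U> = {{c, x}, {e, f}} \<or> \<U> = {{c, d}, {e, f}}" for \<U>
  proof -
    let ?R = "split_quartic ?P \<U>"
    have 3: "split_quartic {d, e, f} {} = restr {d, e, f} ?R"
      by (rule split_quartic_three[OF qsym_split_quartic])
    have 4: "split_quartic {c, d, e, f} {{c, d}} = restr {c, d, e, f} ?R"
      by (rule disjE[OF \<U>]; hypsubst; rule qsym_restr_four[OF qsym_split_quartic qsym_split_quartic refl];
          use dist ne in \<open>simp add: split_quartic_def\<close>)
    have B': "split_quartic {x, d, e, f} {{d, x}} = restr {x, d, e, f} ?R"
      by (rule disjE[OF \<U>]; hypsubst; rule qsym_restr_four[OF qsym_split_quartic qsym_split_quartic refl];
          use dist ne in \<open>simp add: split_quartic_def\<close>)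
    have in_F: "split_struct {d, e, f} \<sigma> {} \<in> F" "split_struct {c, d, e, f} \<sigma> {{c, d}} \<in> F"
      "split_struct {x, d, e, f} \<sigma> {{d, x}} \<in> F" "split_struct ?P \<sigma> \<U> \<in> F"
    proof -
      show "split_struct {d, e, f} \<sigma> {} \<in> F"
        by (rule struct3_in[OF \<sigma>]) (use dist in simp)
      show "split_struct {c, d, e, f} \<sigma> {{c, d}} \<in> F"
        by (rule struct4_in[OF \<sigma> _ refl]) (use dist in simp)
      show "split_struct {x, d, e, f} \<sigma> {{d, x}} \<in> F"
        by (rule struct4_in[OF \<sigma>, of d x e f]) (use dist ne in auto)
      show "split_struct ?P \<sigma> \<U> \<in> F"
        by (rule disjE[OF \<U>]; hypsubst)
          (rule struct5_in[OF \<sigma>, of c x d e f] struct5_in[OF \<sigma>, of c d x e f]; use dist ne in auto)+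
    qed
    show ?thesis
      unfolding split_struct_def 3 4 B'
      by (rule mu_exchange[OF qsym_split_quartic])
        (use in_F in \<open>auto simp: split_struct_def 3 4 B'\<close>)
  qed
  show "branch4 \<sigma> c d e f x * branch \<sigma> d e f c \<asymp> branch4 \<sigma> x d e f c * branch \<sigma> d e f x"
    using exch[of "{{c, x}, {e, f}}"] unfolding branch_def branch4_def sets by simp
  show "inner4 \<sigma> c d e f x * branch \<sigma> d e f c \<asymp> branch4 \<sigma> d x e f c * branch \<sigma> d e f x"
    using exch[of "{{c, d}, {e, f}}"] unfolding branch_def branch4_def inner4_def sets by simp
qed

lemma branch_in_C: "\<lbrakk>colours \<sigma>; distinct [c, d, f, x]\<rbrakk> \<Longrightarrow> branch \<sigma> c d f x \<in> C"
  unfolding branch_def by (rule C_mu[OF branch_emb])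

lemma inner4_in_C:
  assumes \<sigma>: "colours \<sigma>" and dist: "distinct [c, d, e, f, x]"
  shows "inner4 \<sigma> c d e f x \<in> C"
proof -
  let ?P = "{x, c, d, e, f}"
  let ?R = "split_quartic ?P {{c, d}, {e, f}}"
  have ne: "distinct [x, f, e, d, c]" using dist by auto
  have 4: "split_quartic {c, d, e, f} {{c, d}} = restr {c, d, e, f} ?R"
    by (rule qsym_restr_four[OF qsym_split_quartic qsym_split_quartic refl];
        use dist ne in \<open>simp add: split_quartic_def\<close>)
  have "split_struct {c, d, e, f} \<sigma> {{c, d}} \<in> F"
    by (rule struct4_in[of _ c d e f]) (use \<sigma> dist in auto)
  moreover have "split_struct ?P \<sigma> {{c, d}, {e, f}} \<in> F"
    by (rule struct5_in[of _ c d x e f]) (use \<sigma> dist in auto)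
  ultimately have "(split_struct {c, d, e, f} \<sigma> {{c, d}}, incl {c, d, e, f},
      split_struct ?P \<sigma> {{c, d}, {e, f}}) \<in> embs F"
    unfolding split_struct_def 4 by (intro embs_incl[OF qsym_split_quartic]) auto
  then show ?thesis unfolding inner4_def by (rule C_mu)
qed

text \<open>A fresh leaf \<open>e\<close> of colour 1, supplied by the infinite type, takes the
  place of \<open>f\<close>: the insertion into \<open>cd|ef\<close> equals the insertion into
  either star and does not distinguish \<open>e\<close> from \<open>f\<close>.\<close>

lemma branch_recolour:
  assumes \<sigma>: "colours \<sigma>" and dist: "distinct [c, d, f, x]"
  shows "branch \<sigma> c d f x \<asymp> branch (\<sigma>(f := 1)) c d f x"
proof -
  have "infinite (UNIV :: 'a set)" by (rule infinite_UNIV)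
  then obtain e where e: "e \<notin> {c, d, f, x}"
    using ex_new_if_finite[of "{c, d, f, x}"] by auto
  let ?\<sigma> = "\<sigma>(e := 1)"
  have \<sigma>': "colours ?\<sigma>" "colours (\<sigma>(f := 1))" using \<sigma> by auto
  have d5: "distinct [c, d, e, f, x]" "distinct [c, d, f, e, x]" and d4: "distinct [c, d, e, x]"
    using dist e by auto
  have "branch \<sigma> c d f x \<asymp> branch ?\<sigma> c d f x"
    by (rule branch_cong[OF \<sigma> \<sigma>'(1) dist dist]) (use e in auto)
  also have "\<dots> \<asymp> branch4 ?\<sigma> c d e f x" by (rule branch_eqv_branch4[OF \<sigma>'(1) d5(1)])
  also have "\<dots> \<asymp> branch ?\<sigma> c d e x"
    unfolding branch4_commute[of _ c d e] by (rule eqv_sym[OF branch_eqv_branch4[OF \<sigma>'(1) d5(2)]])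
  also have "\<dots> \<asymp> branch (\<sigma>(f := 1)) c d f x"
    by (rule branch_cong[OF \<sigma>' d4 dist]) (use e dist in auto)
  finally show ?thesis .
qed

text \<open>By symmetry in \<open>d\<close> and \<open>f\<close> both can be recoloured to 1, and
  then isomorphism invariance applies.\<close>

lemma branch_by_colour:
  assumes \<sigma>: "colours \<sigma>" "colours \<tau>" and dist: "distinct [c, d, f, x]" "distinct [c', d', f', x']"
    and eq: "\<sigma> c = \<tau> c'" "\<sigma> x = \<tau> x'"
  shows "branch \<sigma> c d f x \<asymp> branch \<tau> c' d' f' x'"
proof -
  have norm: "branch \<sigma> c d f x \<asymp> branch (\<sigma>(f := 1, d := 1)) c d f x"
    if \<sigma>: "colours \<sigma>" and dist: "distinct [c, d, f, x]" for \<sigma> c d f x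
  proof -
    have "branch \<sigma> c d f x \<asymp> branch (\<sigma>(f := 1)) c d f x"
      by (rule branch_recolour[OF that])
    also have "\<dots> \<asymp> branch (\<sigma>(f := 1, d := 1)) c d f x"
      unfolding branch_commute[of _ c d] by (rule branch_recolour) (use that in auto)
    finally show ?thesis .
  qed
  note norm[OF \<sigma>(1) dist(1)]
  also have "branch (\<sigma>(f := 1, d := 1)) c d f x \<asymp> branch (\<tau>(f' := 1, d' := 1)) c' d' f' x'"
    by (rule branch_cong) (use \<sigma> dist eq in auto)
  also have "\<dots> \<asymp> branch \<tau> c' d' f' x'" by (rule eqv_sym[OF norm[OF \<sigma>(2) dist(2)]])
  finally show ?thesis .
qed

lemma one_in_I: "1 \<in> I"
proof -
  obtain A :: "'a set" where "finite A" "card A = 5"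
    using infinite_arbitrarily_large[OF infinite_UNIV] by blast
  then obtain ps where ps: "set ps = A" "distinct ps" using finite_distinct_list by blast
  then have "length ps = 5" using \<open>card A = 5\<close> distinct_card by fastforce
  then obtain c d e f x where "ps = [c, d, e, f, x]"
    by (auto simp: numeral_eq_Suc length_Suc_conv)
  then have dist: "distinct [c, d, e, f, x]" using ps by simp
  have ne: "distinct [x, f, e, d, c]" using dist by auto
  have d4: "distinct [c, d, f, x]" using dist by auto
  \<comment> \<open>\<open>i\<close> is the colour of the branch and \<open>j\<close> that of the
    new leaf; by \<open>branch_by_colour\<close> these determine the class modulo
    \<open>I\<close>.\<close>
  define B where "B i j = branch (\<lambda>a. if a = x then j else if a = c then i else 1) c d f x" for i j :: nat
  have B_in: "B i j \<in> C" if "i \<in> {1, 2}" "j \<in> {1, 2}" for i j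
    unfolding B_def by (rule branch_in_C) (use that d4 in auto)
  have branch_B: "branch \<sigma> c' d' f' x' \<asymp> B (\<sigma> c') (\<sigma> x')"
    if "colours \<sigma>" "distinct [c', d', f', x']" for \<sigma> c' d' f' x'
    unfolding B_def by (rule branch_by_colour) (use that d4 in auto)
  \<comment> \<open>Here \<open>c\<close>, \<open>d\<close>, \<open>x\<close> get the colours
    \<open>i\<close>, \<open>k\<close>, \<open>j\<close>; the extension sum is symmetric in
    \<open>c\<close> and \<open>d\<close> and cancels.\<close>
  have sum_rel: "B k j - (if j = i then 1 else 0) \<asymp> B i j - (if j = k then 1 else 0)"
    if ijk: "i \<in> {1, 2}" "j \<in> {1, 2}" "k \<in> {1, 2}" for i j k
  proof -
    let ?\<sigma> = "\<lambda>a. if a = x then j else if a = c then i else if a = d then k else 1"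
    have \<sigma>: "colours ?\<sigma>" using ijk by auto
    have \<sigma>_eq: "?\<sigma> c = i" "?\<sigma> d = k" "?\<sigma> x = j" using dist by auto
    have dist': "distinct [d, c, e, f, x]" using dist by auto
    have "branch ?\<sigma> d e f x \<asymp> B k j" "branch ?\<sigma> c e f x \<asymp> B i j"
      using branch_B[OF \<sigma>, of d e f x] branch_B[OF \<sigma>, of c e f x] dist unfolding \<sigma>_eq by auto
    then have "B k j \<asymp> extension_sum ?\<sigma> c d e f x + (if j = i then 1 else 0)"
      "B i j \<asymp> extension_sum ?\<sigma> c d e f x + (if j = k then 1 else 0)"
      using branch_eqv_extension_sum[OF \<sigma> dist] branch_eqv_extension_sum[OF \<sigma> dist']
      unfolding \<sigma>_eq extension_sum_commute[of _ d c] by (blast intro: eqv_sym eqv_trans)+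
    note this[THEN eqv_diff, OF eqv_refl]
    from this(1)[of "if j = i then 1 else 0"] this(2)[of "if j = k then 1 else 0"]
    show ?thesis unfolding add_diff_cancel_right' by (rule eqv_trans[OF _ eqv_sym])
  qed
  have cherry_rel: "B i j * B k i \<asymp> B j i * B k j"
    if ijk: "i \<in> {1, 2}" "j \<in> {1, 2}" "k \<in> {1, 2}" for i j k
  proof -
    let ?\<sigma> = "\<lambda>a. if a = x then j else if a = c then i else if a = d then k else 1"
    have \<sigma>: "colours ?\<sigma>" using ijk by auto
    have \<sigma>_eq: "?\<sigma> c = i" "?\<sigma> d = k" "?\<sigma> x = j" using dist by auto
    have 1: "branch4 ?\<sigma> c d e f x \<asymp> B i j"
      using eqv_trans[OF eqv_sym[OF branch_eqv_branch4[OF \<sigma> dist]] branch_B[OF \<sigma> d4]] unfolding \<sigma>_eq .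
    have 2: "branch4 ?\<sigma> x d e f c \<asymp> B j i"
      using eqv_trans[OF eqv_sym[OF branch_eqv_branch4[OF \<sigma>, of x d e f c]] branch_B[OF \<sigma>, of x d f c]]
        dist ne unfolding \<sigma>_eq by simp
    have 3: "branch ?\<sigma> d e f c \<asymp> B k i" "branch ?\<sigma> d e f x \<asymp> B k j"
      using branch_B[OF \<sigma>, of d e f c] branch_B[OF \<sigma>, of d e f x] dist ne unfolding \<sigma>_eq by simp_all
    have in_C: "branch ?\<sigma> d e f c \<in> C" "branch ?\<sigma> d e f x \<in> C"
      by (rule branch_in_C[OF \<sigma>]; use dist ne in simp)+
    show ?thesis
      using eqv_trans[OF eqv_sym[OF eqv_mult[OF 1 3(1) B_in[OF ijk(1,2)] in_C(1)]]
          eqv_trans[OF branch_cherry[OF \<sigma> dist] eqv_mult[OF 2 3(2) B_in[OF ijk(2,1)] in_C(2)]]] .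
  qed
  \<comment> \<open>The two sides of the inner edge get different colours and \<open>x\<close>
    shares that of \<open>c\<close> and \<open>d\<close>, so reading \<open>g\<close> from the two
    sides gives different values.\<close>
  let ?\<sigma> = "\<lambda>a. if a \<in> {e, f} then 2 else 1 :: nat"
  have \<sigma>: "colours ?\<sigma>" by auto
  have \<sigma>_eq: "?\<sigma> c = 1" "?\<sigma> d = 1" "?\<sigma> e = 2" "?\<sigma> f = 2" "?\<sigma> x = 1" using dist ne by simp_all
  define g where "g = inner4 ?\<sigma> c d e f x"
  have g_in: "g \<in> C" unfolding g_def by (rule inner4_in_C[OF \<sigma> dist])
  have inner_rel: "inner4 ?\<sigma> c' d' e' f' x * B (?\<sigma> d') (?\<sigma> c') \<asymp> B (?\<sigma> d') (?\<sigma> c') * B (?\<sigma> d') (?\<sigma> x)"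
    if dist': "distinct [c', d', e', f', x]" for c' d' e' f'
  proof -
    have ne': "distinct [x, f', e', d', c']" using dist' by auto
    have 1: "branch4 ?\<sigma> d' x e' f' c' \<asymp> B (?\<sigma> d') (?\<sigma> c')"
      by (rule eqv_trans[OF eqv_sym[OF branch_eqv_branch4[OF \<sigma>]] branch_B[OF \<sigma>]])
        (use dist' ne' in simp_all)
    have 2: "branch ?\<sigma> d' e' f' c' \<asymp> B (?\<sigma> d') (?\<sigma> c')" "branch ?\<sigma> d' e' f' x \<asymp> B (?\<sigma> d') (?\<sigma> x)"
      by (rule branch_B[OF \<sigma>]; use dist' ne' in simp)+
    have in_C: "branch ?\<sigma> d' e' f' c' \<in> C" "branch ?\<sigma> d' e' f' x \<in> C"
      by (rule branch_in_C[OF \<sigma>]; use dist' ne' in simp)+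
    have B: "B (?\<sigma> d') (?\<sigma> c') \<in> C" by (rule B_in) auto
    show ?thesis
      using eqv_trans[OF eqv_sym[OF eqv_mult[OF eqv_refl 2(1) inner4_in_C[OF \<sigma> dist'] in_C(1)]]
          eqv_trans[OF branch_inner[OF \<sigma> dist'] eqv_mult[OF 1 2(2) B in_C(2)]]] .
  qed
  have "distinct [c, d, e, f]" "distinct [e, f, c, d, x]" using dist ne by auto
  \<comment> \<open>The second relation reads \<open>g\<close> from the side of \<open>e\<close>,
    \<open>f\<close>, by \<open>inner4_commute\<close>.\<close>
  then have inner: "g * B 1 1 - B 1 1 * B 1 1 \<in> I" "g * B 2 2 - B 2 2 * B 2 1 \<in> I"
    using inner_rel[OF dist] inner_rel[of e f c d] inner4_commute[of c d e f ?\<sigma> x]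
    unfolding \<sigma>_eq g_def eqv_def by simp_all
  have sums: "B 2 1 - B 1 1 - 1 \<in> I" "B 1 2 - B 2 2 - 1 \<in> I"
    using sum_rel[of 1 1 2] sum_rel[of 2 2 1] I_minus by (auto simp: eqv_def algebra_simps)
  have cherries: "B 1 2 * B 1 1 - B 2 1 * B 1 2 \<in> I" "B 2 1 * B 2 2 - B 1 2 * B 2 1 \<in> I"
    using cherry_rel[of 1 2 1] cherry_rel[of 2 1 2] by (simp_all add: eqv_def)
  \<comment> \<open>Multiplying \<open>B 2 1 - B 1 1 - 1\<close> by \<open>B 1 2\<close> and adding
    the first cherry relation leaves \<open>- B 1 2\<close>.\<close>
  have B12: "B 1 2 \<in> I"
    using I_minus[OF I_add[OF cherries(1) I_mult[OF B_in[of 1 2] sums(1)]]] by (simp add: algebra_simps)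
  have B21: "B 2 1 \<in> I"
    using I_minus[OF I_add[OF cherries(2) I_mult[OF B_in[of 2 1] sums(2)]]] by (simp add: algebra_simps)
  have B11: "B 1 1 + 1 \<in> I" using I_diff[OF B21 sums(1)] by simp
  have B22: "B 2 2 + 1 \<in> I" using I_diff[OF B12 sums(2)] by simp
  \<comment> \<open>Modulo \<open>I\<close>, with \<open>B 2 2\<close> equal to -1 and
    \<open>B 2 1\<close> to 0, the second inner relation reduces to \<open>- g\<close>.\<close>
  have "g \<in> I"
    using I_diff[OF I_add[OF I_mult[OF g_in B22] I_minus[OF I_mult[OF B_in[of 2 2] B21]]] inner(2)]
    by (simp add: algebra_simps)
  \<comment> \<open>With \<open>B 1 1\<close> equal to -1 modulo \<open>I\<close>, the first inner
    relation reduces to \<open>- g - 1\<close>.\<close>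
  moreover have "g + 1 \<in> I"
  proof -
    have "B 1 1 * (B 1 1 + 1) - (B 1 1 + 1) \<in> I"
      using I_diff[OF I_mult[OF B_in[of 1 1] B11] B11] by simp
    then have *: "B 1 1 * B 1 1 - 1 \<in> I" by (simp add: algebra_simps)
    have "g * (B 1 1 + 1) - (g * B 1 1 - B 1 1 * B 1 1) - (B 1 1 * B 1 1 - 1) \<in> I"
      using I_diff[OF I_diff[OF I_mult[OF g_in B11] inner(1)] *] .
    then show ?thesis by (simp add: algebra_simps)
  qed
  ultimately show ?thesis using I_diff[of "g + 1" g] by simp
qed

end

section \<open>The measure ring and complex measures\<close>

lemma measure_mod_Theta:
  assumes "tree_class F"
  shows "measure_mod F var (carrier (int_poly_ring (embs F)))
    (Idl\<^bsub>int_poly_ring (embs F)\<^esub> (Theta_rels F))"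
proof -
  let ?R = "int_poly_ring (embs F)"
  let ?I = "Idl\<^bsub>?R\<^esub> (Theta_rels F)"
  interpret tree_class F by fact
  interpret R: cring ?R by (rule cring_int_poly_ring)
  interpret I: ideal ?I ?R by (rule R.genideal_ideal[OF Theta_rels_subset])
  have ops: "x \<oplus>\<^bsub>?R\<^esub> y = x + y" "x \<otimes>\<^bsub>?R\<^esub> y = x * y" "\<zero>\<^bsub>?R\<^esub> = 0" "\<one>\<^bsub>?R\<^esub> = 1" for x y
    by (simp_all add: int_poly_ring_def)
  have rels: "Theta_rels F \<subseteq> ?I" by (rule R.genideal_self[OF Theta_rels_subset])
  have uminus: "- p \<in> carrier ?R" if "p \<in> carrier ?R" for p
    using that by (simp add: int_poly_ring_def Poly_Mapping.keys.rep_eq)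
  show ?thesis
  proof unfold_locales
    show "1 \<in> carrier ?R" using R.one_closed ops by simp
    show "a - b \<in> carrier ?R" if "a \<in> carrier ?R" "b \<in> carrier ?R" for a b
      using R.a_closed[OF that(1) uminus[OF that(2)]] ops by simp
    show "var E \<in> carrier ?R" if "E \<in> embs F" for E
      using that by (auto simp: var_def int_poly_ring_def)
    show "0 \<in> ?I" using additive_subgroup.zero_closed[OF I.additive_subgroup_axioms] ops by simp
    show "a + b \<in> ?I" if "a \<in> ?I" "b \<in> ?I" for a b
      using additive_subgroup.a_closed[OF I.additive_subgroup_axioms that] ops by simp
    show "a * b \<in> ?I" if "a \<in> carrier ?R" "b \<in> ?I" for a b
      using I.I_l_closed[OF that(2,1)] ops by simp
    \<comment> \<open>The three measure rules hold for the variables because the differences in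
      question are generators of the ideal.\<close>
    show "var (X, f, Y) - 1 \<in> ?I" if "(X, f, Y) \<in> embs F" "iso_map X Y f" for X f Y
      by (rule subsetD[OF rels], unfold Theta_rels_def, rule UnI1, rule UnI1, rule CollectI, (rule exI)+, (rule conjI refl that)+)
    show "var (X, compose (pts X) g f, Z) - var (Y, g, Z) * var (X, f, Y) \<in> ?I"
      if "(X, f, Y) \<in> embs F" "(Y, g, Z) \<in> embs F" for X f Y g Z
      by (rule subsetD[OF rels], unfold Theta_rels_def, rule UnI1, rule UnI2, rule CollectI, (rule exI)+, (rule conjI refl that)+)
    show "var (W, i, X) - (\<Sum>(Z, j', i') \<in> S. var (Y, i', Z)) \<in> ?I"
      if "(W, i, X) \<in> embs F" "(W, j, Y) \<in> embs F" "all_amalgs F W X Y i j S" for W i X j Y S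
      by (rule subsetD[OF rels], unfold Theta_rels_def, rule UnI2, rule CollectI, (rule exI)+, (rule conjI refl that)+)
  qed
qed

lemma Theta_trivial:
  fixes F :: "('a::infinite, tree_sym) rstruct set"
  assumes "tree_class F"
  shows "Theta F \<simeq> zero_ring"
proof -
  let ?R = "int_poly_ring (embs F)"
  let ?I = "Idl\<^bsub>?R\<^esub> (Theta_rels F)"
  interpret R: cring ?R by (rule cring_int_poly_ring)
  interpret I: ideal ?I ?R by (rule R.genideal_ideal[OF Theta_rels_subset])
  interpret T: cring "Theta F" by (rule cring_Theta)
  have "1 \<in> ?I" using measure_mod.one_in_I[OF measure_mod_Theta[OF assms]] .
  then have "\<one>\<^bsub>?R\<^esub> \<in> ?I" by (simp add: int_poly_ring_def)
  then have "?I = carrier ?R" by (rule I.one_imp_carrier)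
  then have "?I +>\<^bsub>?R\<^esub> a = ?I" if "a \<in> carrier ?R" for a
    using I.a_rcos_const that by (simp only:)
  \<comment> \<open>All cosets coincide with the ideal, and there is one because the ring contains
    zero.\<close>
  then have "carrier (Theta F) = {?I}"
    unfolding Theta_def FactRing_def A_RCOSETS_def' partial_object.simps
    using R.zero_closed by (metis (no_types, lifting) SUP_cong UN_constant empty_iff)
  then have "(\<lambda>_. ()) \<in> ring_iso (Theta F) zero_ring"
    by (auto simp: ring_iso_def ring_hom_def zero_ring_def bij_betw_def)
  then show ?thesis unfolding is_ring_iso_def by blast
qed

lemma no_emb_measure:
  fixes F :: "('a::infinite, tree_sym) rstruct set"
  assumes "tree_class F"
  shows "\<not> emb_measure F \<mu>"
proof
  assume \<mu>: "emb_measure F \<mu>"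
  interpret tree_class F by fact
  \<comment> \<open>With the zero ideal congruence is equality, and 1 cannot lie in that
    ideal.\<close>
  interpret measure_mod F \<mu> UNIV "{0}"
    by unfold_locales (use \<mu> in \<open>simp_all add: emb_measure_def\<close>)
  show False using one_in_I by simp
qed

theorem theorem3p2:
  fixes n k :: nat
  assumes "n \<ge> 2" and "k \<ge> 3"
  shows "Theta (colored_trees n :: ('a::infinite, tree_sym) rstruct set) \<simeq> zero_ring
    \<and> Theta (colored_trees_deg n k :: ('a, tree_sym) rstruct set) \<simeq> zero_ring
    \<and> (\<nexists>\<mu>. emb_measure (colored_trees n :: ('a, tree_sym) rstruct set) \<mu>)
    \<and> (\<nexists>\<mu>. emb_measure (colored_trees_deg n k :: ('a, tree_sym) rstruct set) \<mu>)"
  using Theta_trivial no_emb_measure tree_class_colored_trees[OF assms(1)]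
    tree_class_colored_trees_deg[OF assms] by blast

end
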